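(* Let $R$ be a Noetherian domain (not necessarily commutative) that is an algebra over a field $K$ of characteristic $0$, with a locally nilpotent derivation $d$ and an element $x\in R$ with $d(x)=1$. Suppose that $S=R[\theta;d]$ satisfies property $(\diamond)$. If there exists $a\in R\setminus R^d$ such that $S/S(\theta+a)$ is Artinian as a left $S$-module, then $R^d$ is a division ring.
   Context: A derivation $d$ of a ring $R$ is an additive map with $d(ab)=d(a)b+ad(b)$; it is locally nilpotent if for every $a\in R$ there is $n>0$ with $d^n(a)=0$. $R^d=\{a\in R\mid d(a)=0\}$ is the subring of constants. The differential operator ring $R[\theta;d]$ is the overring of $R$ that is free as a left $R$-module with basis $\{\theta^n\mid n\ge 0\}$, subject to $\theta a=a\theta+d(a)$ for all $a\in R$. A module is locally Artinian if each of its finitely generated submodules is Artinian. A ring $A$ satisfies property $(\diamond)$ if injective hulls of simple left $A$-modules are locally Artinian (equivalently, all finitely generated essential extensions of simple left $A$-modules are Artinian). *)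

theory Defs
  imports "HOL-Algebra.Algebra"
begin

text \<open>
  The library's locales \<open>domain\<close>, \<open>module\<close> and \<open>algebra\<close> require commutative rings, and its
  \<open>noetherian_ring\<close> speaks about two-sided ideals only.  The notions below are their
  noncommutative counterparts, over the same records.  The fields \<open>mult\<close> and \<open>one\<close> of the record
  type \<open>module\<close> play no role when it is used for left modules.
\<close>

section \<open>Noncommutative rings\<close>

locale nc_domain = ring +
  assumes one_not_zero: "\<one> \<noteq> \<zero>"
    and no_zero_divisors:
      "\<lbrakk> a \<otimes> b = \<zero>; a \<in> carrier R; b \<in> carrier R \<rbrakk> \<Longrightarrow> a = \<zero> \<or> b = \<zero>"

text \<open>In the zero ring \<open>\<zero>\<close> is a unit, so the equation below forces \<open>\<one> \<noteq> \<zero>\<close>.\<close>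

locale skew_field = ring +
  assumes Units_eq: "Units R = carrier R - {\<zero>}"

text \<open>As the library's \<open>algebra\<close>, but \<open>M\<close> may be noncommutative; hence the second compatibility
  law, which makes the scalars central.\<close>

locale nc_algebra = module + ring M +
  assumes smult_mult_left:
      "\<lbrakk> k \<in> carrier R; x \<in> carrier M; y \<in> carrier M \<rbrakk> \<Longrightarrow>
        (k \<odot>\<^bsub>M\<^esub> x) \<otimes>\<^bsub>M\<^esub> y = k \<odot>\<^bsub>M\<^esub> (x \<otimes>\<^bsub>M\<^esub> y)"
    and smult_mult_right:
      "\<lbrakk> k \<in> carrier R; x \<in> carrier M; y \<in> carrier M \<rbrakk> \<Longrightarrow>
        x \<otimes>\<^bsub>M\<^esub> (k \<odot>\<^bsub>M\<^esub> y) = k \<odot>\<^bsub>M\<^esub> (x \<otimes>\<^bsub>M\<^esub> y)"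

definition characteristic_zero :: "('a, 'c) ring_scheme \<Rightarrow> bool" where
  "characteristic_zero K \<longleftrightarrow> (\<forall>n::nat. n > 0 \<longrightarrow> [n] \<cdot>\<^bsub>K\<^esub> \<one>\<^bsub>K\<^esub> \<noteq> \<zero>\<^bsub>K\<^esub>)"

definition opposite_ring :: "('a, 'c) ring_scheme \<Rightarrow> ('a, 'c) ring_scheme" where
  "opposite_ring R = R\<lparr>monoid.mult := \<lambda>x y. y \<otimes>\<^bsub>R\<^esub> x\<rparr>"


section \<open>Left modules\<close>

locale left_module = R?: ring R + M?: abelian_group M
  for R :: "('a, 'c) ring_scheme" (structure) and M :: "('a, 'b, 'd) module_scheme" (structure) +
  assumes smult_closed:
      "\<lbrakk> a \<in> carrier R; x \<in> carrier M \<rbrakk> \<Longrightarrow> a \<odot>\<^bsub>M\<^esub> x \<in> carrier M"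
    and smult_l_distr:
      "\<lbrakk> a \<in> carrier R; b \<in> carrier R; x \<in> carrier M \<rbrakk> \<Longrightarrow>
        (a \<oplus> b) \<odot>\<^bsub>M\<^esub> x = a \<odot>\<^bsub>M\<^esub> x \<oplus>\<^bsub>M\<^esub> b \<odot>\<^bsub>M\<^esub> x"
    and smult_r_distr:
      "\<lbrakk> a \<in> carrier R; x \<in> carrier M; y \<in> carrier M \<rbrakk> \<Longrightarrow>
        a \<odot>\<^bsub>M\<^esub> (x \<oplus>\<^bsub>M\<^esub> y) = a \<odot>\<^bsub>M\<^esub> x \<oplus>\<^bsub>M\<^esub> a \<odot>\<^bsub>M\<^esub> y"
    and smult_assoc1:
      "\<lbrakk> a \<in> carrier R; b \<in> carrier R; x \<in> carrier M \<rbrakk> \<Longrightarrow>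
        (a \<otimes> b) \<odot>\<^bsub>M\<^esub> x = a \<odot>\<^bsub>M\<^esub> (b \<odot>\<^bsub>M\<^esub> x)"
    and smult_one:
      "x \<in> carrier M \<Longrightarrow> \<one> \<odot>\<^bsub>M\<^esub> x = x"

definition regular_module :: "('a, 'c) ring_scheme \<Rightarrow> ('a, 'a) module" where
  "regular_module R = \<lparr>carrier = carrier R, monoid.mult = monoid.mult R, one = one R,
     ring.zero = ring.zero R, add = add R, smult = monoid.mult R\<rparr>"

definition quotient_module :: "('a, 'b, 'd) module_scheme \<Rightarrow> 'b set \<Rightarrow> ('a, 'b set) module" where
  "quotient_module M N = \<lparr>carrier = a_rcosets\<^bsub>M\<^esub> N, monoid.mult = undefined, one = undefined,
     ring.zero = N, add = set_add M, smult = (\<lambda>r Y. \<Union>x\<in>Y. N +>\<^bsub>M\<^esub> (r \<odot>\<^bsub>M\<^esub> x))\<rparr>"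

definition principal_left_ideal :: "('a, 'c) ring_scheme \<Rightarrow> 'a \<Rightarrow> 'a set" where
  "principal_left_ideal R s = {r \<otimes>\<^bsub>R\<^esub> s | r. r \<in> carrier R}"

definition submodule_generated ::
  "('a, 'c) ring_scheme \<Rightarrow> ('a, 'b, 'd) module_scheme \<Rightarrow> 'b set \<Rightarrow> 'b set" where
  "submodule_generated R M Y = \<Inter>{N. submodule N R M \<and> Y \<subseteq> N}"

definition noetherian_module ::
  "('a, 'c) ring_scheme \<Rightarrow> ('a, 'b, 'd) module_scheme \<Rightarrow> bool" where
  "noetherian_module R M \<longleftrightarrow> left_module R M \<and>
     (\<forall>N :: nat \<Rightarrow> 'b set. (\<forall>i. submodule (N i) R M \<and> N i \<subseteq> N (Suc i)) \<longrightarrow>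
        (\<exists>k. \<forall>i\<ge>k. N i = N k))"

definition artinian_module ::
  "('a, 'c) ring_scheme \<Rightarrow> ('a, 'b, 'd) module_scheme \<Rightarrow> bool" where
  "artinian_module R M \<longleftrightarrow> left_module R M \<and>
     (\<forall>N :: nat \<Rightarrow> 'b set. (\<forall>i. submodule (N i) R M \<and> N (Suc i) \<subseteq> N i) \<longrightarrow>
        (\<exists>k. \<forall>i\<ge>k. N i = N k))"

definition locally_artinian_module ::
  "('a, 'c) ring_scheme \<Rightarrow> ('a, 'b, 'd) module_scheme \<Rightarrow> bool" where
  "locally_artinian_module R M \<longleftrightarrow> left_module R M \<and>
     (\<forall>Y. finite Y \<and> Y \<subseteq> carrier M \<longrightarrow>
        artinian_module R (M\<lparr>carrier := submodule_generated R M Y\<rparr>))"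

definition simple_module ::
  "('a, 'c) ring_scheme \<Rightarrow> ('a, 'b, 'd) module_scheme \<Rightarrow> bool" where
  "simple_module R M \<longleftrightarrow> left_module R M \<and> carrier M \<noteq> {\<zero>\<^bsub>M\<^esub>} \<and>
     (\<forall>N. submodule N R M \<longrightarrow> N = {\<zero>\<^bsub>M\<^esub>} \<or> N = carrier M)"

definition nc_noetherian :: "('a, 'c) ring_scheme \<Rightarrow> bool" where
  "nc_noetherian R \<longleftrightarrow> noetherian_module R (regular_module R) \<and>
     noetherian_module (opposite_ring R) (regular_module (opposite_ring R))"


section \<open>Injective hulls and property \<open>(\<diamond>)\<close>\<close>

definition left_module_hom ::
  "('a, 'c) ring_scheme \<Rightarrow> ('a, 'b, 'd) module_scheme \<Rightarrow> ('a, 'e, 'f) module_scheme \<Rightarrow> ('b \<Rightarrow> 'e) set"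
  where
  "left_module_hom R M N = {f \<in> carrier M \<rightarrow> carrier N.
     (\<forall>x\<in>carrier M. \<forall>y\<in>carrier M. f (x \<oplus>\<^bsub>M\<^esub> y) = f x \<oplus>\<^bsub>N\<^esub> f y) \<and>
     (\<forall>r\<in>carrier R. \<forall>x\<in>carrier M. f (r \<odot>\<^bsub>M\<^esub> x) = r \<odot>\<^bsub>N\<^esub> f x)}"

text \<open>
  A definition cannot quantify over all types, so the test modules \<open>B\<close> have their elements in
  \<^typ>\<open>'a + 'b\<close>.  This is no restriction: the regular module has a copy there, and by Baer's
  criterion the inclusions of left ideals into the regular module suffice as test cases.
\<close>

definition injective_module ::
  "('a, 'c) ring_scheme \<Rightarrow> ('a, 'b, 'd) module_scheme \<Rightarrow> bool" where
  "injective_module R E \<longleftrightarrow> left_module R E \<and>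
     (\<forall>(B :: ('a, 'a + 'b) module) A f.
        left_module R B \<and> submodule A R B \<and> f \<in> left_module_hom R (B\<lparr>carrier := A\<rparr>) E \<longrightarrow>
        (\<exists>g \<in> left_module_hom R B E. \<forall>x\<in>A. g x = f x))"

definition essential_submodule ::
  "('a, 'c) ring_scheme \<Rightarrow> 'b set \<Rightarrow> ('a, 'b, 'd) module_scheme \<Rightarrow> bool" where
  "essential_submodule R V E \<longleftrightarrow> submodule V R E \<and>
     (\<forall>N. submodule N R E \<and> N \<noteq> {\<zero>\<^bsub>E\<^esub>} \<longrightarrow> N \<inter> V \<noteq> {\<zero>\<^bsub>E\<^esub>})"

definition injective_hull ::
  "('a, 'c) ring_scheme \<Rightarrow> 'b set \<Rightarrow> ('a, 'b, 'd) module_scheme \<Rightarrow> bool" where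
  "injective_hull R V E \<longleftrightarrow> injective_module R E \<and> essential_submodule R V E"

text \<open>
  Property \<open>(\<diamond>)\<close>.  Here, too, the type of the elements of \<open>E\<close> has to be fixed, and
  \<^typ>\<open>'a \<Rightarrow> 'a set\<close> is large enough to contain an isomorphic copy of every injective hull of a
  simple left \<open>A\<close>-module \<open>V\<close>.  Indeed \<open>V\<close> is a quotient of \<open>A\<close>.  If \<open>A\<close> is infinite, \<open>V\<close> lies in a
  divisible group \<open>D\<close> with \<open>|D| \<le> |A|\<close>, and its hull lies in the injective module of additive maps
  from \<open>A\<close> to \<open>D\<close>.  If \<open>A\<close> is finite, the hull lies in the character module of \<open>A\<close>, which has
  \<open>|A|\<close> elements.
\<close>

definition diamond :: "('a, 'c) ring_scheme \<Rightarrow> bool" where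
  "diamond A \<longleftrightarrow> (\<forall>(E :: ('a, 'a \<Rightarrow> 'a set) module) V.
     injective_hull A V E \<and> simple_module A (E\<lparr>carrier := V\<rparr>) \<longrightarrow> locally_artinian_module A E)"


section \<open>Derivations and differential operator rings\<close>

definition derivation :: "('a, 'c) ring_scheme \<Rightarrow> ('a \<Rightarrow> 'a) \<Rightarrow> bool" where
  "derivation R d \<longleftrightarrow> d \<in> carrier R \<rightarrow> carrier R \<and>
     (\<forall>a\<in>carrier R. \<forall>b\<in>carrier R. d (a \<oplus>\<^bsub>R\<^esub> b) = d a \<oplus>\<^bsub>R\<^esub> d b) \<and>
     (\<forall>a\<in>carrier R. \<forall>b\<in>carrier R. d (a \<otimes>\<^bsub>R\<^esub> b) = d a \<otimes>\<^bsub>R\<^esub> b \<oplus>\<^bsub>R\<^esub> a \<otimes>\<^bsub>R\<^esub> d b)"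

definition locally_nilpotent :: "('a, 'c) ring_scheme \<Rightarrow> ('a \<Rightarrow> 'a) \<Rightarrow> bool" where
  "locally_nilpotent R d \<longleftrightarrow> (\<forall>a\<in>carrier R. \<exists>n>0. (d ^^ n) a = \<zero>\<^bsub>R\<^esub>)"

definition constants :: "('a, 'c) ring_scheme \<Rightarrow> ('a \<Rightarrow> 'a) \<Rightarrow> 'a set" where
  "constants R d = {a \<in> carrier R. d a = \<zero>\<^bsub>R\<^esub>}"

text \<open>
  \<open>S = R[\<theta>; d]\<close>, where \<open>R\<close> is identified with its image under \<open>\<iota>\<close>.  The last clause says that the
  powers of \<open>\<theta>\<close> form a basis of \<open>S\<close> as a left \<open>R\<close>-module; in particular \<open>\<iota>\<close> is injective.  These
  conditions determine \<open>S\<close> up to an isomorphism over \<open>R\<close> that preserves \<open>\<theta>\<close>.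
\<close>

definition diff_op_ring ::
  "('r, 'c) ring_scheme \<Rightarrow> ('r \<Rightarrow> 'r) \<Rightarrow> ('s, 'd) ring_scheme \<Rightarrow> ('r \<Rightarrow> 's) \<Rightarrow> 's \<Rightarrow> bool" where
  "diff_op_ring R d S \<iota> \<theta> \<longleftrightarrow> ring S \<and> \<iota> \<in> ring_hom R S \<and> \<theta> \<in> carrier S \<and>
     (\<forall>a\<in>carrier R. \<theta> \<otimes>\<^bsub>S\<^esub> \<iota> a = \<iota> a \<otimes>\<^bsub>S\<^esub> \<theta> \<oplus>\<^bsub>S\<^esub> \<iota> (d a)) \<and>
     (\<forall>s\<in>carrier S. \<exists>!c :: nat \<Rightarrow> 'r. range c \<subseteq> carrier R \<and> finite {n. c n \<noteq> \<zero>\<^bsub>R\<^esub>} \<and>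
        s = (\<Oplus>\<^bsub>S\<^esub>n\<in>{n. c n \<noteq> \<zero>\<^bsub>R\<^esub>}. \<iota> (c n) \<otimes>\<^bsub>S\<^esub> \<theta> [^]\<^bsub>S\<^esub> n))"

end

theory Submission
  imports Defs
begin

text \<open>
  Let \<open>L = S(\<theta> + a)\<theta>\<close>.  Right multiplication by \<open>\<theta>\<close> maps \<open>S/S(\<theta> + a)\<close> onto \<open>S\<theta>/L\<close>, which is therefore
  Artinian, and comparing degrees with respect to \<open>d\<close> shows that \<open>S\<theta>/L\<close> is essential in \<open>S/L\<close>; this is
  where \<open>a \<notin> R\<^sup>d\<close> is needed.  Property \<open>(\<diamond>)\<close> makes all cyclic modules with a smallest nonzero submodule
  Artinian.  Finitely many such quotients of \<open>S/L\<close> suffice to separate the points of \<open>S\<theta>/L\<close>, and hence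
  those of \<open>S/L\<close>, so \<open>S/L\<close> and its quotient \<open>S/S\<theta> \<cong> R\<close> are Artinian.  For a nonzero constant \<open>c\<close> the
  submodules \<open>R c\<^sup>n\<close> of \<open>R\<close> form a descending chain, hence \<open>c\<close> is left invertible.

  To apply \<open>(\<diamond>)\<close>, one needs injective hulls.  Since \<open>S\<close> contains a field \<open>F\<close>, the module \<open>S/N\<close>
  embeds into the injective module of all \<open>F\<close>-linear maps from \<open>S\<close> to \<open>S/N\<close>.
\<close>

section \<open>Submodules of left modules\<close>

text \<open>\<open>diamond\<close> speaks of hulls whose elements have one fixed type,
  \<open>'s \<Rightarrow> 's set\<close> for the ring \<open>S\<close>. Cosets in \<open>S\<close>
  are sets, so the maps from \<open>S\<close> to \<open>S/N\<close> have exactly this type, and the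
  hull is cut out of them as a direct summand. Over the field \<open>F\<close> every linear map on a
  subspace extends, which is what makes these maps an injective module.

  Artinian quotients and subquotients of \<open>S\<close> are treated as chain conditions on left
  ideals between two given ones, so that intersecting, enlarging and comparing them takes place
  inside \<open>S\<close>.

  The condition on \<open>a\<close> acts through the degree: a nonconstant \<open>a\<close> has
  positive degree, so multiplying by it raises the degree, whereas \<open>d\<close> never does.
  Characteristic 0 keeps the top coefficient, a binomial coefficient, from vanishing. Left inverses
  suffice in the end, because a nonzero ring in which every nonzero element has one is a division
  ring; and a left inverse of a nonzero constant is again a constant because \<open>R\<close> has no
  zero divisors.\<close>

context left_module
begin

lemma smult_l_zero [simp]: "x \<in> carrier M \<Longrightarrow> \<zero> \<odot>\<^bsub>M\<^esub> x = \<zero>\<^bsub>M\<^esub>"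
  using smult_l_distr[of \<zero> \<zero> x] smult_closed[of \<zero> x] by (metis M.add.r_cancel_one' R.zero_closed R.l_zero)

lemma smult_r_zero [simp]: "a \<in> carrier R \<Longrightarrow> a \<odot>\<^bsub>M\<^esub> \<zero>\<^bsub>M\<^esub> = \<zero>\<^bsub>M\<^esub>"
  using smult_r_distr[of a "\<zero>\<^bsub>M\<^esub>" "\<zero>\<^bsub>M\<^esub>"] smult_closed[of a "\<zero>\<^bsub>M\<^esub>"]
  by (metis M.add.r_cancel_one' M.zero_closed M.l_zero)

lemma smult_minus_one: "x \<in> carrier M \<Longrightarrow> (\<ominus> \<one>) \<odot>\<^bsub>M\<^esub> x = \<ominus>\<^bsub>M\<^esub> x"
  using smult_l_distr[of "\<ominus> \<one>" \<one> x] smult_closed[of "\<ominus> \<one>" x] smult_one[of x]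
  by (simp add: R.l_neg M.minus_equality)

lemma submoduleI:
  assumes sub: "H \<subseteq> carrier M"
    and zero: "\<zero>\<^bsub>M\<^esub> \<in> H"
    and add: "\<And>a b. \<lbrakk> a \<in> H; b \<in> H \<rbrakk> \<Longrightarrow> a \<oplus>\<^bsub>M\<^esub> b \<in> H"
    and smult: "\<And>a x. \<lbrakk> a \<in> carrier R; x \<in> H \<rbrakk> \<Longrightarrow> a \<odot>\<^bsub>M\<^esub> x \<in> H"
  shows "submodule H R M"
proof -
  have "\<ominus>\<^bsub>M\<^esub> x \<in> H" if "x \<in> H" for x
    using smult[of "\<ominus> \<one>" x] smult_minus_one[of x] that sub by auto
  then show ?thesis
    using assms unfolding submodule_def submodule_axioms_def subgroup_def
    by (auto simp: a_inv_def)
qed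

lemma submoduleD:
  assumes "submodule H R M"
  shows "H \<subseteq> carrier M"
    and "\<And>x. x \<in> H \<Longrightarrow> x \<in> carrier M"
    and "\<zero>\<^bsub>M\<^esub> \<in> H"
    and "\<And>a b. \<lbrakk> a \<in> H; b \<in> H \<rbrakk> \<Longrightarrow> a \<oplus>\<^bsub>M\<^esub> b \<in> H"
    and "\<And>a x. \<lbrakk> a \<in> carrier R; x \<in> H \<rbrakk> \<Longrightarrow> a \<odot>\<^bsub>M\<^esub> x \<in> H"
    and "\<And>x. x \<in> H \<Longrightarrow> \<ominus>\<^bsub>M\<^esub> x \<in> H"
    and "\<And>a b. \<lbrakk> a \<in> H; b \<in> H \<rbrakk> \<Longrightarrow> a \<ominus>\<^bsub>M\<^esub> b \<in> H"
proof -
  interpret H: submodule H R M by fact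
  show *: "H \<subseteq> carrier M" "\<And>x. x \<in> H \<Longrightarrow> x \<in> carrier M" "\<zero>\<^bsub>M\<^esub> \<in> H"
    "\<And>a b. \<lbrakk> a \<in> H; b \<in> H \<rbrakk> \<Longrightarrow> a \<oplus>\<^bsub>M\<^esub> b \<in> H"
    "\<And>a x. \<lbrakk> a \<in> carrier R; x \<in> H \<rbrakk> \<Longrightarrow> a \<odot>\<^bsub>M\<^esub> x \<in> H"
    using H.subset H.one_closed H.m_closed H.smult_closed by auto
  show **: "\<And>x. x \<in> H \<Longrightarrow> \<ominus>\<^bsub>M\<^esub> x \<in> H"
    using smult_minus_one *(2,5) by (metis R.add.inv_closed R.one_closed)
  show "\<And>a b. \<lbrakk> a \<in> H; b \<in> H \<rbrakk> \<Longrightarrow> a \<ominus>\<^bsub>M\<^esub> b \<in> H"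
    using * ** by (simp add: a_minus_def)
qed

lemma carrier_submodule: "submodule (carrier M) R M"
  by (rule submoduleI) (auto simp: smult_closed)

lemma zero_submodule: "submodule {\<zero>\<^bsub>M\<^esub>} R M"
  by (rule submoduleI) auto

lemma submodule_Int:
  assumes "submodule N R M" "submodule P R M"
  shows "submodule (N \<inter> P) R M"
  using submoduleD(1)[OF assms(1)]
  by (intro submoduleI) (auto simp: assms submoduleD(3-5)[OF assms(1)] submoduleD(3-5)[OF assms(2)])

section \<open>Sums of submodules and cyclic submodules\<close>

lemma mem_set_add: "x \<in> N <+>\<^bsub>M\<^esub> P \<longleftrightarrow> (\<exists>a\<in>N. \<exists>b\<in>P. x = a \<oplus>\<^bsub>M\<^esub> b)"
  by (auto simp: set_add_def')

lemma set_addI: "a \<in> N \<Longrightarrow> b \<in> P \<Longrightarrow> a \<oplus>\<^bsub>M\<^esub> b \<in> N <+>\<^bsub>M\<^esub> P"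
  by (auto simp: mem_set_add)

lemma set_addE:
  assumes "x \<in> N <+>\<^bsub>M\<^esub> P"
  obtains a b where "a \<in> N" "b \<in> P" "x = a \<oplus>\<^bsub>M\<^esub> b"
  using assms by (auto simp: mem_set_add)

lemma submodule_set_add:
  assumes N: "submodule N R M" and P: "submodule P R M"
  shows "submodule (N <+>\<^bsub>M\<^esub> P) R M" "N \<subseteq> N <+>\<^bsub>M\<^esub> P" "P \<subseteq> N <+>\<^bsub>M\<^esub> P"
proof -
  note n = submoduleD(2-5)[OF N] and p = submoduleD(2-5)[OF P]
  show "submodule (N <+>\<^bsub>M\<^esub> P) R M"
  proof (rule submoduleI)
    show "N <+>\<^bsub>M\<^esub> P \<subseteq> carrier M" by (auto elim!: set_addE simp: n(1) p(1))
    show "\<zero>\<^bsub>M\<^esub> \<in> N <+>\<^bsub>M\<^esub> P" using set_addI[OF n(2) p(2)] by simp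
  next
    fix x y assume "x \<in> N <+>\<^bsub>M\<^esub> P" "y \<in> N <+>\<^bsub>M\<^esub> P"
    then obtain a b a' b' where ab: "a \<in> N" "b \<in> P" "a' \<in> N" "b' \<in> P"
      "x = a \<oplus>\<^bsub>M\<^esub> b" "y = a' \<oplus>\<^bsub>M\<^esub> b'" by (auto elim!: set_addE)
    then have "x \<oplus>\<^bsub>M\<^esub> y = (a \<oplus>\<^bsub>M\<^esub> a') \<oplus>\<^bsub>M\<^esub> (b \<oplus>\<^bsub>M\<^esub> b')"
      by (simp add: M.a_ac n(1) p(1))
    then show "x \<oplus>\<^bsub>M\<^esub> y \<in> N <+>\<^bsub>M\<^esub> P" using ab by (simp add: set_addI n(3) p(3))
  next
    fix r x assume r: "r \<in> carrier R" and "x \<in> N <+>\<^bsub>M\<^esub> P"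
    then obtain a b where ab: "a \<in> N" "b \<in> P" "x = a \<oplus>\<^bsub>M\<^esub> b" by (auto elim!: set_addE)
    then show "r \<odot>\<^bsub>M\<^esub> x \<in> N <+>\<^bsub>M\<^esub> P"
      using r by (simp add: smult_r_distr n(1) p(1) set_addI n(4) p(4))
  qed
  show "N \<subseteq> N <+>\<^bsub>M\<^esub> P" using set_addI[OF _ p(2)] n(1) by fastforce
  show "P \<subseteq> N <+>\<^bsub>M\<^esub> P" using set_addI[OF n(2)] p(1) by fastforce
qed

definition cyclic :: "'b \<Rightarrow> 'b set" where
  "cyclic x = {r \<odot>\<^bsub>M\<^esub> x | r. r \<in> carrier R}"

lemma cyclicI: "r \<in> carrier R \<Longrightarrow> r \<odot>\<^bsub>M\<^esub> x \<in> cyclic x"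
  unfolding cyclic_def by blast

lemma cyclicE:
  assumes "y \<in> cyclic x"
  obtains r where "r \<in> carrier R" "y = r \<odot>\<^bsub>M\<^esub> x"
  using assms unfolding cyclic_def by blast

lemma submodule_cyclic:
  assumes x: "x \<in> carrier M"
  shows "submodule (cyclic x) R M"
proof (rule submoduleI)
  show "cyclic x \<subseteq> carrier M" using x by (auto elim!: cyclicE simp: smult_closed)
  show "\<zero>\<^bsub>M\<^esub> \<in> cyclic x" using x smult_l_zero[of x] cyclicI[of \<zero> x] by simp
next
  fix a b assume "a \<in> cyclic x" "b \<in> cyclic x"
  then obtain r s where "r \<in> carrier R" "s \<in> carrier R" "a = r \<odot>\<^bsub>M\<^esub> x" "b = s \<odot>\<^bsub>M\<^esub> x"
    by (auto elim!: cyclicE)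
  then show "a \<oplus>\<^bsub>M\<^esub> b \<in> cyclic x"
    using x smult_l_distr[of r s x] cyclicI[of "r \<oplus> s" x] by simp
next
  fix s a assume s: "s \<in> carrier R" and "a \<in> cyclic x"
  then obtain r where "r \<in> carrier R" "a = r \<odot>\<^bsub>M\<^esub> x" by (auto elim!: cyclicE)
  then show "s \<odot>\<^bsub>M\<^esub> a \<in> cyclic x"
    using s x smult_assoc1[of s r x] cyclicI[of "s \<otimes> r" x] by simp
qed

lemma cyclic_self: "x \<in> carrier M \<Longrightarrow> x \<in> cyclic x"
  using smult_one[of x] cyclicI[of \<one> x] by simp

lemma cyclic_subset: "submodule N R M \<Longrightarrow> x \<in> N \<Longrightarrow> cyclic x \<subseteq> N"
  using submoduleD(5) unfolding cyclic_def by auto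

text \<open>Turns the conclusion of \<open>diamond\<close>, which concerns finitely generated
  submodules, into a statement about the multiples of one element.\<close>

lemma submodule_generated_singleton:
  "x \<in> carrier M \<Longrightarrow> submodule_generated R M {x} = cyclic x"
  unfolding submodule_generated_def using cyclic_subset submodule_cyclic cyclic_self by blast

text \<open>Two elements of the union lie in a common member because the members are comparable. The
  predicate \<open>Q\<close> matches the form of the chains that Zorn's lemma supplies.\<close>

lemma submodule_Union_chain:
  assumes "C \<noteq> {}" "subset.chain {N. submodule N R M \<and> Q N} C"
  shows "submodule (\<Union>C) R M"
proof (rule submoduleI)
  have sub: "submodule N R M" if "N \<in> C" for N
    using assms that by (auto simp: subset_chain_def)
  show "\<Union>C \<subseteq> carrier M" using submoduleD(1)[OF sub] by blast
  show "\<zero>\<^bsub>M\<^esub> \<in> \<Union>C" using submoduleD(3)[OF sub] assms(1) by blast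
  show "a \<odot>\<^bsub>M\<^esub> x \<in> \<Union>C" if "a \<in> carrier R" "x \<in> \<Union>C" for a x
    using submoduleD(5)[OF sub] that by blast
  fix a b assume "a \<in> \<Union>C" "b \<in> \<Union>C"
  then obtain N P where NP: "N \<in> C" "P \<in> C" "a \<in> N" "b \<in> P" by blast
  then have "N \<subseteq> P \<or> P \<subseteq> N" using assms(2) by (auto simp: subset_chain_def)
  then obtain T where "T \<in> C" "a \<in> T" "b \<in> T" using NP by blast
  then show "a \<oplus>\<^bsub>M\<^esub> b \<in> \<Union>C" using submoduleD(4)[OF sub] by blast
qed

text \<open>Zorn's lemma. The closure hypothesis concerns all nonempty chains with \<open>Q\<close>;
  lying above \<open>N\<^sub>0\<close> is inherited by unions and is treated inside the
  proof.\<close>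

lemma maximal_submodule:
  assumes "submodule N\<^sub>0 R M" "Q N\<^sub>0"
    and "\<And>C. \<lbrakk> C \<noteq> {}; subset.chain {N. submodule N R M \<and> Q N} C; submodule (\<Union>C) R M \<rbrakk> \<Longrightarrow> Q (\<Union>C)"
  obtains N where "submodule N R M" "Q N" "N\<^sub>0 \<subseteq> N"
    "\<And>P. \<lbrakk> submodule P R M; Q P; N \<subseteq> P \<rbrakk> \<Longrightarrow> P = N"
proof -
  let ?A = "{N. submodule N R M \<and> (Q N \<and> N\<^sub>0 \<subseteq> N)}"
  have "\<exists>N\<in>?A. \<forall>P\<in>?A. N \<subseteq> P \<longrightarrow> P = N"
  proof (rule subset_Zorn_nonempty)
    show "?A \<noteq> {}" using assms(1,2) by blast
    fix C assume C: "C \<noteq> {}" "subset.chain ?A C"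
    then have "submodule (\<Union>C) R M" by (rule submodule_Union_chain)
    moreover have "subset.chain {N. submodule N R M \<and> Q N} C"
      using C(2) by (auto simp: subset_chain_def)
    moreover have "N\<^sub>0 \<subseteq> \<Union>C" using C unfolding subset_chain_def by blast
    ultimately show "\<Union>C \<in> ?A" using assms(3)[OF C(1)] by blast
  qed
  then obtain N where N: "N \<in> ?A" and max: "\<forall>P\<in>?A. N \<subseteq> P \<longrightarrow> P = N" ..
  show thesis
  proof (rule that[of N])
    fix P assume "submodule P R M" "Q P" "N \<subseteq> P"
    then show "P = N" using N max by blast
  qed (use N in auto)
qed

text \<open>Used with two kinds of \<open>W\<close>. If \<open>W\<close> consists of the nonzero
  elements of a submodule, the result is a trial complement that is as large as possible. If
  \<open>W = {w}\<close>, every submodule strictly above \<open>N\<close> contains \<open>w\<close>,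
  so the quotient by \<open>N\<close> has a smallest nonzero submodule.\<close>

lemma maximal_submodule_avoiding:
  assumes "submodule N\<^sub>0 R M" "N\<^sub>0 \<inter> W = {}"
  obtains N where "submodule N R M" "N \<inter> W = {}" "N\<^sub>0 \<subseteq> N"
    "\<And>P. \<lbrakk> submodule P R M; P \<inter> W = {}; N \<subseteq> P \<rbrakk> \<Longrightarrow> P = N"
proof (rule maximal_submodule[of N\<^sub>0 "\<lambda>N. N \<inter> W = {}"])
  fix C assume "C \<noteq> {}" "subset.chain {N. submodule N R M \<and> N \<inter> W = {}} C"
  then show "\<Union>C \<inter> W = {}" by (auto simp: subset_chain_def)
qed (use assms that in auto)

lemma submodule_left_module:
  assumes "submodule H R M"
  shows "left_module R (M\<lparr>carrier := H\<rparr>)"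
proof -
  interpret H: submodule H R M by fact
  note h = submoduleD[OF assms]
  have "abelian_group (M\<lparr>carrier := H\<rparr>)"
  proof (rule abelian_groupI)
    fix x assume "x \<in> carrier (M\<lparr>carrier := H\<rparr>)"
    then show "\<exists>y\<in>carrier (M\<lparr>carrier := H\<rparr>). y \<oplus>\<^bsub>M\<lparr>carrier := H\<rparr>\<^esub> x = \<zero>\<^bsub>M\<lparr>carrier := H\<rparr>\<^esub>"
      using h(2,6) M.l_neg by auto
  qed (use h in \<open>auto simp: M.a_ac\<close>)
  then show ?thesis
    by (intro left_module.intro left_module_axioms.intro R.ring_axioms)
      (simp_all add: h smult_l_distr smult_r_distr smult_assoc1 smult_one)
qed

lemma submodule_restrict_iff:
  assumes "submodule H R M"
  shows "submodule N R (M\<lparr>carrier := H\<rparr>) \<longleftrightarrow> submodule N R M \<and> N \<subseteq> H"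
proof -
  interpret H: left_module R "M\<lparr>carrier := H\<rparr>" by (rule submodule_left_module) fact
  show ?thesis
  proof
    assume N: "submodule N R (M\<lparr>carrier := H\<rparr>)"
    note n = H.submoduleD[OF N, simplified]
    have "submodule N R M" using n(1) submoduleD(1)[OF assms] by (intro submoduleI n(3-5)) auto
    with n(1) show "submodule N R M \<and> N \<subseteq> H" by simp
  next
    assume N: "submodule N R M \<and> N \<subseteq> H"
    then show "submodule N R (M\<lparr>carrier := H\<rparr>)"
      using submoduleD[of N] by (intro H.submoduleI) simp_all
  qed
qed

end

section \<open>Quotients, homomorphisms and summands\<close>

context left_module
begin

section \<open>Cosets and the quotient module\<close>

lemma mem_coset_iff:
  assumes N: "submodule N R M" and x: "x \<in> carrier M"
  shows "y \<in> N +>\<^bsub>M\<^esub> x \<longleftrightarrow> y \<in> carrier M \<and> y \<ominus>\<^bsub>M\<^esub> x \<in> N"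
proof
  assume "y \<in> N +>\<^bsub>M\<^esub> x"
  then obtain n where "n \<in> N" "y = n \<oplus>\<^bsub>M\<^esub> x" by (auto simp: a_r_coset_def')
  then show "y \<in> carrier M \<and> y \<ominus>\<^bsub>M\<^esub> x \<in> N"
    using x submoduleD(2)[OF N] by (simp add: M.minus_eq M.add.m_assoc M.r_neg)
next
  assume y: "y \<in> carrier M \<and> y \<ominus>\<^bsub>M\<^esub> x \<in> N"
  then have "y = (y \<ominus>\<^bsub>M\<^esub> x) \<oplus>\<^bsub>M\<^esub> x" using x by (simp add: M.minus_eq M.add.m_assoc M.l_neg)
  then show "y \<in> N +>\<^bsub>M\<^esub> x" using y by (auto simp: a_r_coset_def')
qed

lemma coset_eq_iff:
  assumes N: "submodule N R M" and x: "x \<in> carrier M" and y: "y \<in> carrier M"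
  shows "N +>\<^bsub>M\<^esub> x = N +>\<^bsub>M\<^esub> y \<longleftrightarrow> x \<ominus>\<^bsub>M\<^esub> y \<in> N"
proof
  assume "N +>\<^bsub>M\<^esub> x = N +>\<^bsub>M\<^esub> y"
  moreover have "x \<in> N +>\<^bsub>M\<^esub> x"
    using x submoduleD(3)[OF N] by (simp add: mem_coset_iff[OF N] M.minus_eq M.r_neg)
  ultimately show "x \<ominus>\<^bsub>M\<^esub> y \<in> N" using mem_coset_iff[OF N y] by blast
next
  assume xy: "x \<ominus>\<^bsub>M\<^esub> y \<in> N"
  have "\<ominus>\<^bsub>M\<^esub> (x \<ominus>\<^bsub>M\<^esub> y) = y \<ominus>\<^bsub>M\<^esub> x"
    using x y by (simp add: M.minus_eq M.minus_add M.add.m_comm)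
  then have yx: "y \<ominus>\<^bsub>M\<^esub> x \<in> N" using submoduleD(6)[OF N xy] by simp
  have trans: "u \<ominus>\<^bsub>M\<^esub> w \<in> N"
    if "u \<ominus>\<^bsub>M\<^esub> v \<in> N" "v \<ominus>\<^bsub>M\<^esub> w \<in> N" "u \<in> carrier M" "v \<in> carrier M" "w \<in> carrier M" for u v w
  proof -
    have "u \<ominus>\<^bsub>M\<^esub> w = (u \<ominus>\<^bsub>M\<^esub> v) \<oplus>\<^bsub>M\<^esub> (v \<ominus>\<^bsub>M\<^esub> w)"
      using that(3-5) by (simp add: M.minus_eq M.add.m_assoc M.r_neg1 M.r_neg2)
    then show ?thesis using submoduleD(4)[OF N that(1,2)] by simp
  qed
  have "z \<ominus>\<^bsub>M\<^esub> x \<in> N \<longleftrightarrow> z \<ominus>\<^bsub>M\<^esub> y \<in> N" if z: "z \<in> carrier M" for z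
    using trans[OF _ xy z x y] trans[OF _ yx z y x] by blast
  then show "N +>\<^bsub>M\<^esub> x = N +>\<^bsub>M\<^esub> y"
    using mem_coset_iff[OF N x] mem_coset_iff[OF N y] by blast
qed

context
  fixes N assumes N: "submodule N R M"
begin

lemma carrier_quotient: "carrier (quotient_module M N) = (\<lambda>x. N +>\<^bsub>M\<^esub> x) ` carrier M"
  by (auto simp: quotient_module_def A_RCOSETS_def')

lemma zero_quotient: "\<zero>\<^bsub>quotient_module M N\<^esub> = N +>\<^bsub>M\<^esub> \<zero>\<^bsub>M\<^esub>"
  using submoduleD(1)[OF N] by (simp add: quotient_module_def)

lemma add_quotient:
  assumes "x \<in> carrier M" "y \<in> carrier M"
  shows "(N +>\<^bsub>M\<^esub> x) \<oplus>\<^bsub>quotient_module M N\<^esub> (N +>\<^bsub>M\<^esub> y) = N +>\<^bsub>M\<^esub> (x \<oplus>\<^bsub>M\<^esub> y)"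
proof -
  interpret abelian_subgroup N M
    by (rule abelian_subgroupI3)
      (use N in \<open>auto simp: additive_subgroup_def submodule_def M.abelian_group_axioms\<close>)
  show ?thesis using assms by (simp add: quotient_module_def a_rcos_sum)
qed

text \<open>The action is defined by a union over all representatives of the coset. All sets in this
  union agree, because \<open>r\<close> maps the difference of two representatives, an element of
  \<open>N\<close>, into \<open>N\<close>.\<close>

lemma smult_quotient:
  assumes r: "r \<in> carrier R" and x: "x \<in> carrier M"
  shows "r \<odot>\<^bsub>quotient_module M N\<^esub> (N +>\<^bsub>M\<^esub> x) = N +>\<^bsub>M\<^esub> (r \<odot>\<^bsub>M\<^esub> x)"
proof -
  have "N +>\<^bsub>M\<^esub> (r \<odot>\<^bsub>M\<^esub> y) = N +>\<^bsub>M\<^esub> (r \<odot>\<^bsub>M\<^esub> x)" if "y \<in> N +>\<^bsub>M\<^esub> x" for y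
  proof -
    have y: "y \<in> carrier M" "y \<ominus>\<^bsub>M\<^esub> x \<in> N" using that mem_coset_iff[OF N x] by auto
    then have "y = (y \<ominus>\<^bsub>M\<^esub> x) \<oplus>\<^bsub>M\<^esub> x" using x by (simp add: M.minus_eq M.add.m_assoc M.l_neg)
    then have "r \<odot>\<^bsub>M\<^esub> y = r \<odot>\<^bsub>M\<^esub> (y \<ominus>\<^bsub>M\<^esub> x) \<oplus>\<^bsub>M\<^esub> r \<odot>\<^bsub>M\<^esub> x"
      using r x y submoduleD(2)[OF N] by (metis smult_r_distr)
    moreover have "r \<odot>\<^bsub>M\<^esub> (y \<ominus>\<^bsub>M\<^esub> x) \<in> N" using r y submoduleD(5)[OF N] by simp
    ultimately have "r \<odot>\<^bsub>M\<^esub> y \<in> N +>\<^bsub>M\<^esub> (r \<odot>\<^bsub>M\<^esub> x)" by (auto simp: a_r_coset_def')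
    then show ?thesis
      using r x y by (simp add: coset_eq_iff[OF N] mem_coset_iff[OF N] smult_closed)
  qed
  moreover have "x \<in> N +>\<^bsub>M\<^esub> x"
    using x submoduleD(3)[OF N] by (simp add: mem_coset_iff[OF N] M.minus_eq M.r_neg)
  ultimately have "(\<Union>y\<in>N +>\<^bsub>M\<^esub> x. N +>\<^bsub>M\<^esub> (r \<odot>\<^bsub>M\<^esub> y)) = N +>\<^bsub>M\<^esub> (r \<odot>\<^bsub>M\<^esub> x)"
    by (intro UN_constant_eq) blast+
  then show ?thesis by (simp add: quotient_module_def)
qed

lemma quotient_left_module: "left_module R (quotient_module M N)"
proof (intro left_module.intro left_module_axioms.intro R.ring_axioms)
  let ?Q = "quotient_module M N"
  have ex: "\<exists>x\<in>carrier M. u = N +>\<^bsub>M\<^esub> x" if "u \<in> carrier ?Q" for u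
    using that by (auto simp: carrier_quotient)
  have in_Q: "N +>\<^bsub>M\<^esub> x \<in> carrier ?Q" if "x \<in> carrier M" for x
    using that by (auto simp: carrier_quotient)
  note q = add_quotient smult_quotient zero_quotient in_Q
  show "abelian_group ?Q"
  proof (rule abelian_groupI)
    fix u assume "u \<in> carrier ?Q"
    then obtain x where x: "x \<in> carrier M" "u = N +>\<^bsub>M\<^esub> x" using ex by blast
    show "\<zero>\<^bsub>?Q\<^esub> \<oplus>\<^bsub>?Q\<^esub> u = u" using x by (simp add: q)
    show "\<exists>v\<in>carrier ?Q. v \<oplus>\<^bsub>?Q\<^esub> u = \<zero>\<^bsub>?Q\<^esub>"
      using x by (intro bexI[of _ "N +>\<^bsub>M\<^esub> (\<ominus>\<^bsub>M\<^esub> x)"]) (simp_all add: q M.l_neg)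
    fix v assume "v \<in> carrier ?Q"
    then obtain y where y: "y \<in> carrier M" "v = N +>\<^bsub>M\<^esub> y" using ex by blast
    show "u \<oplus>\<^bsub>?Q\<^esub> v \<in> carrier ?Q" using x y by (simp add: q)
    show "u \<oplus>\<^bsub>?Q\<^esub> v = v \<oplus>\<^bsub>?Q\<^esub> u" using x y by (simp add: q M.add.m_comm)
    fix w assume "w \<in> carrier ?Q"
    then obtain z where z: "z \<in> carrier M" "w = N +>\<^bsub>M\<^esub> z" using ex by blast
    show "u \<oplus>\<^bsub>?Q\<^esub> v \<oplus>\<^bsub>?Q\<^esub> w = u \<oplus>\<^bsub>?Q\<^esub> (v \<oplus>\<^bsub>?Q\<^esub> w)" using x y z by (simp add: q M.add.m_assoc)
  qed (simp add: q)
  fix u assume "u \<in> carrier ?Q"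
  then obtain x where x: "x \<in> carrier M" "u = N +>\<^bsub>M\<^esub> x" using ex by blast
  show "\<one> \<odot>\<^bsub>?Q\<^esub> u = u" using x by (simp add: q smult_one)
  fix a assume a: "a \<in> carrier R"
  show "a \<odot>\<^bsub>?Q\<^esub> u \<in> carrier ?Q" using a x by (simp add: q smult_closed)
  { fix b assume b: "b \<in> carrier R"
    show "(a \<oplus> b) \<odot>\<^bsub>?Q\<^esub> u = a \<odot>\<^bsub>?Q\<^esub> u \<oplus>\<^bsub>?Q\<^esub> b \<odot>\<^bsub>?Q\<^esub> u"
      using a b x by (simp add: q smult_closed smult_l_distr)
    show "(a \<otimes> b) \<odot>\<^bsub>?Q\<^esub> u = a \<odot>\<^bsub>?Q\<^esub> (b \<odot>\<^bsub>?Q\<^esub> u)"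
      using a b x by (simp add: q smult_closed smult_assoc1) }
  fix v assume "v \<in> carrier ?Q"
  then obtain y where y: "y \<in> carrier M" "v = N +>\<^bsub>M\<^esub> y" using ex by blast
  show "a \<odot>\<^bsub>?Q\<^esub> (u \<oplus>\<^bsub>?Q\<^esub> v) = a \<odot>\<^bsub>?Q\<^esub> u \<oplus>\<^bsub>?Q\<^esub> a \<odot>\<^bsub>?Q\<^esub> v"
    using a x y by (simp add: q smult_closed smult_r_distr)
qed

end

text \<open>The difference \<open>a - a'\<close> equals \<open>c' - c\<close>, hence lies in both
  submodules.\<close>

lemma submodule_unique_decomposition:
  assumes A: "submodule A R M" and C: "submodule C R M" and AC: "A \<inter> C = {\<zero>\<^bsub>M\<^esub>}"
    and "a \<in> A" "a' \<in> A" "c \<in> C" "c' \<in> C" "a \<oplus>\<^bsub>M\<^esub> c = a' \<oplus>\<^bsub>M\<^esub> c'"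
  shows "a = a'"
proof -
  note a = submoduleD(2)[OF A] and c = submoduleD(2)[OF C]
  have "a \<ominus>\<^bsub>M\<^esub> a' = (a \<oplus>\<^bsub>M\<^esub> c) \<ominus>\<^bsub>M\<^esub> (a' \<oplus>\<^bsub>M\<^esub> c)"
    using assms(4-7) by (simp add: a c M.minus_eq M.minus_add M.a_ac M.r_neg)
  also have "\<dots> = c' \<ominus>\<^bsub>M\<^esub> c"
    unfolding assms(8) using assms(4-7) M.add.m_comm[of a' c']
    by (simp add: a c M.minus_eq M.minus_add M.add.m_assoc M.r_neg1 M.r_neg2)
  finally have "a \<ominus>\<^bsub>M\<^esub> a' = c' \<ominus>\<^bsub>M\<^esub> c" .
  then have "a \<ominus>\<^bsub>M\<^esub> a' \<in> A \<inter> C"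
    using submoduleD(7)[OF A, of a a'] submoduleD(7)[OF C, of c' c] assms(4-7) by simp
  then have "a \<ominus>\<^bsub>M\<^esub> a' = \<zero>\<^bsub>M\<^esub>" using AC by blast
  then have "\<ominus>\<^bsub>M\<^esub> (\<ominus>\<^bsub>M\<^esub> a') = a"
    using assms(4,5) by (intro M.minus_equality) (simp_all add: a M.minus_eq)
  then show ?thesis using assms(5) by (simp add: a)
qed

text \<open>This projection is used in two ways: precomposing with it extends a linear map over a
  skew field, and an extension of it to all of \<open>M\<close> becomes the retraction onto a
  summand. The trivial intersection makes the description by \<open>THE\<close> well
  defined.\<close>

lemma projection_hom:
  assumes A: "submodule A R M" and C: "submodule C R M" and AC: "A \<inter> C = {\<zero>\<^bsub>M\<^esub>}"
  obtains p where "p \<in> left_module_hom R (M\<lparr>carrier := A <+>\<^bsub>M\<^esub> C\<rparr>) (M\<lparr>carrier := A\<rparr>)"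
    "\<And>a. a \<in> A \<Longrightarrow> p a = a" "\<And>c. c \<in> C \<Longrightarrow> p c = \<zero>\<^bsub>M\<^esub>"
proof -
  note a = submoduleD[OF A] and c = submoduleD[OF C]
  define p where "p b = (THE a. a \<in> A \<and> (\<exists>c\<in>C. b = a \<oplus>\<^bsub>M\<^esub> c))" for b
  have p: "p (a \<oplus>\<^bsub>M\<^esub> c) = a" if "a \<in> A" "c \<in> C" for a c
    unfolding p_def using that submodule_unique_decomposition[OF A C AC] by (intro the_equality) blast+
  show thesis
  proof (rule that)
    show "p a = a" if "a \<in> A" for a using p[OF that c(3)] a(2)[OF that] by simp
    show "p c = \<zero>\<^bsub>M\<^esub>" if "c \<in> C" for c using p[OF a(3) that] c(2)[OF that] by simp
    show "p \<in> left_module_hom R (M\<lparr>carrier := A <+>\<^bsub>M\<^esub> C\<rparr>) (M\<lparr>carrier := A\<rparr>)"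
      unfolding left_module_hom_def
    proof (intro CollectI conjI ballI funcsetI; simp)
      show "p x \<in> A" if "x \<in> A <+>\<^bsub>M\<^esub> C" for x using that p by (auto elim!: set_addE)
      fix x assume "x \<in> A <+>\<^bsub>M\<^esub> C"
      then obtain a1 c1 where 1: "a1 \<in> A" "c1 \<in> C" "x = a1 \<oplus>\<^bsub>M\<^esub> c1" by (auto elim!: set_addE)
      { fix y assume "y \<in> A <+>\<^bsub>M\<^esub> C"
        then obtain a2 c2 where 2: "a2 \<in> A" "c2 \<in> C" "y = a2 \<oplus>\<^bsub>M\<^esub> c2" by (auto elim!: set_addE)
        have "x \<oplus>\<^bsub>M\<^esub> y = (a1 \<oplus>\<^bsub>M\<^esub> a2) \<oplus>\<^bsub>M\<^esub> (c1 \<oplus>\<^bsub>M\<^esub> c2)"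
          using 1 2 by (simp add: a(2) c(2) M.a_ac)
        then show "p (x \<oplus>\<^bsub>M\<^esub> y) = p x \<oplus>\<^bsub>M\<^esub> p y"
          using p[of "a1 \<oplus>\<^bsub>M\<^esub> a2" "c1 \<oplus>\<^bsub>M\<^esub> c2"] 1 2 by (simp add: p a(4) c(4)) }
      { fix r assume r: "r \<in> carrier R"
        have "r \<odot>\<^bsub>M\<^esub> x = r \<odot>\<^bsub>M\<^esub> a1 \<oplus>\<^bsub>M\<^esub> r \<odot>\<^bsub>M\<^esub> c1"
          using 1 r by (simp add: a(2) c(2) smult_r_distr)
        then show "p (r \<odot>\<^bsub>M\<^esub> x) = r \<odot>\<^bsub>M\<^esub> p x"
          using p[of "r \<odot>\<^bsub>M\<^esub> a1" "r \<odot>\<^bsub>M\<^esub> c1"] 1 r by (simp add: p a(5) c(5)) }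
    qed
  qed
qed

end

section \<open>Homomorphisms: extension over skew fields, images and preimages, summands\<close>

lemma left_module_hom_comp:
  "f \<in> left_module_hom R M N \<Longrightarrow> g \<in> left_module_hom R N P \<Longrightarrow> g \<circ> f \<in> left_module_hom R M P"
  unfolding left_module_hom_def by (simp add: Pi_iff)

text \<open>Subspaces have complements. Let \<open>C\<close> be maximal among the submodules meeting
  \<open>A\<close> trivially. If \<open>b\<close> were outside \<open>A + C\<close>, then
  \<open>C + T b\<close> would contain a nonzero \<open>y + q b\<close> in \<open>A\<close>; here
  \<open>q\<close> is nonzero, and dividing by it puts \<open>b\<close> into \<open>A + C\<close>.
  The extension is \<open>f\<close> after the projection onto \<open>A\<close>.\<close>

lemma skew_field_hom_extension:
  assumes "skew_field T" "left_module T B" and A: "submodule A T B"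
    and f: "f \<in> left_module_hom T (B\<lparr>carrier := A\<rparr>) D"
  obtains g where "g \<in> left_module_hom T B D" "\<And>x. x \<in> A \<Longrightarrow> g x = f x"
proof -
  interpret T: skew_field T by fact
  interpret B: left_module T B by fact
  note a = B.submoduleD[OF A]
  obtain C where C: "submodule C T B" "C \<inter> (A - {\<zero>\<^bsub>B\<^esub>}) = {}"
    and max: "\<And>P. \<lbrakk> submodule P T B; P \<inter> (A - {\<zero>\<^bsub>B\<^esub>}) = {}; C \<subseteq> P \<rbrakk> \<Longrightarrow> P = C"
    by (rule B.maximal_submodule_avoiding[OF B.zero_submodule, of "A - {\<zero>\<^bsub>B\<^esub>}"]) auto
  note c = B.submoduleD[OF C(1)]
  have AC: "A \<inter> C = {\<zero>\<^bsub>B\<^esub>}" using C(2) a(3) c(3) by auto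
  have "b \<in> A <+>\<^bsub>B\<^esub> C" if b: "b \<in> carrier B" for b
  proof (rule ccontr)
    assume nb: "b \<notin> A <+>\<^bsub>B\<^esub> C"
    let ?C = "C <+>\<^bsub>B\<^esub> B.cyclic b"
    note C' = B.submodule_set_add[OF C(1) B.submodule_cyclic[OF b]]
    have "b \<notin> C" using nb B.submodule_set_add(3)[OF A C(1)] by blast
    then have "?C \<noteq> C" using C'(3) B.cyclic_self[OF b] by blast
    then have "?C \<inter> (A - {\<zero>\<^bsub>B\<^esub>}) \<noteq> {}" using max C' by blast
    then obtain y q where y: "y \<in> C" and q: "q \<in> carrier T"
      and yq: "y \<oplus>\<^bsub>B\<^esub> q \<odot>\<^bsub>B\<^esub> b \<in> A" "y \<oplus>\<^bsub>B\<^esub> q \<odot>\<^bsub>B\<^esub> b \<noteq> \<zero>\<^bsub>B\<^esub>"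
      by (auto elim!: B.set_addE B.cyclicE)
    have "q \<noteq> \<zero>\<^bsub>T\<^esub>"
    proof
      assume "q = \<zero>\<^bsub>T\<^esub>"
      then have "y \<in> A" "y \<noteq> \<zero>\<^bsub>B\<^esub>" using yq y c(2) b by auto
      then show False using AC y by blast
    qed
    then have "q \<in> Units T" using q T.Units_eq by blast
    then obtain r where r: "r \<in> carrier T" "r \<otimes>\<^bsub>T\<^esub> q = \<one>\<^bsub>T\<^esub>" by (auto simp: Units_def)
    have qb: "q \<odot>\<^bsub>B\<^esub> b \<in> carrier B" using q b by (rule B.smult_closed)
    have "b = r \<odot>\<^bsub>B\<^esub> (q \<odot>\<^bsub>B\<^esub> b)"
      using r q b B.smult_assoc1[of r q b] B.smult_one by simp
    also have "q \<odot>\<^bsub>B\<^esub> b = (y \<oplus>\<^bsub>B\<^esub> q \<odot>\<^bsub>B\<^esub> b) \<oplus>\<^bsub>B\<^esub> (\<ominus>\<^bsub>B\<^esub> y)"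
      using qb c(2)[OF y] B.M.add.m_comm[of y] by (simp add: B.M.add.m_assoc B.M.r_neg)
    also have "r \<odot>\<^bsub>B\<^esub> \<dots> \<in> A <+>\<^bsub>B\<^esub> C"
      using B.submoduleD(5)[OF B.submodule_set_add(1)[OF A C(1)] r(1) B.set_addI[OF yq(1) c(6)[OF y]]] .
    finally show False using nb by simp
  qed
  then have sum: "A <+>\<^bsub>B\<^esub> C = carrier B"
    using B.submoduleD(1)[OF B.submodule_set_add(1)[OF A C(1)]] by blast
  obtain p where p: "p \<in> left_module_hom T (B\<lparr>carrier := A <+>\<^bsub>B\<^esub> C\<rparr>) (B\<lparr>carrier := A\<rparr>)"
    "\<And>a. a \<in> A \<Longrightarrow> p a = a"
    using B.projection_hom[OF A C(1) AC] by blast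
  have "f \<circ> p \<in> left_module_hom T B D"
    using left_module_hom_comp[OF p(1) f] unfolding sum by (simp add: left_module_hom_def)
  then show thesis using p(2) by (intro that[of "f \<circ> p"]) auto
qed

lemma left_module_homI:
  assumes "\<And>x. x \<in> carrier M \<Longrightarrow> f x \<in> carrier N"
    and "\<And>x y. x \<in> carrier M \<Longrightarrow> y \<in> carrier M \<Longrightarrow> f (x \<oplus>\<^bsub>M\<^esub> y) = f x \<oplus>\<^bsub>N\<^esub> f y"
    and "\<And>r x. r \<in> carrier R \<Longrightarrow> x \<in> carrier M \<Longrightarrow> f (r \<odot>\<^bsub>M\<^esub> x) = r \<odot>\<^bsub>N\<^esub> f x"
  shows "f \<in> left_module_hom R M N"
  using assms unfolding left_module_hom_def by simp

lemma left_module_homD: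
  assumes "f \<in> left_module_hom R M N"
  shows "\<And>x. x \<in> carrier M \<Longrightarrow> f x \<in> carrier N"
    and "\<And>x y. x \<in> carrier M \<Longrightarrow> y \<in> carrier M \<Longrightarrow> f (x \<oplus>\<^bsub>M\<^esub> y) = f x \<oplus>\<^bsub>N\<^esub> f y"
    and "\<And>r x. r \<in> carrier R \<Longrightarrow> x \<in> carrier M \<Longrightarrow> f (r \<odot>\<^bsub>M\<^esub> x) = r \<odot>\<^bsub>N\<^esub> f x"
  using assms unfolding left_module_hom_def by (simp_all add: Pi_iff)

lemma left_module_hom_zero:
  assumes "left_module R M" "left_module R N" "f \<in> left_module_hom R M N"
  shows "f \<zero>\<^bsub>M\<^esub> = \<zero>\<^bsub>N\<^esub>"
proof -
  interpret M: left_module R M by fact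
  interpret N: left_module R N by fact
  have "f (\<zero>\<^bsub>R\<^esub> \<odot>\<^bsub>M\<^esub> \<zero>\<^bsub>M\<^esub>) = \<zero>\<^bsub>R\<^esub> \<odot>\<^bsub>N\<^esub> f \<zero>\<^bsub>M\<^esub>"
    by (rule left_module_homD(3)[OF assms(3) M.R.zero_closed M.M.zero_closed])
  then show ?thesis using left_module_homD(1)[OF assms(3)] by simp
qed

lemma submodule_image:
  assumes "left_module R M" "left_module R N" and f: "f \<in> left_module_hom R M N"
    and P: "submodule P R M"
  shows "submodule (f ` P) R N"
proof -
  interpret M: left_module R M by fact
  interpret N: left_module R N by fact
  note p = M.submoduleD[OF P] and h = left_module_homD[OF f]
  show ?thesis
  proof (rule N.submoduleI)
    show "f ` P \<subseteq> carrier N" using p(2) h(1) by blast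
    show "\<zero>\<^bsub>N\<^esub> \<in> f ` P"
      by (rule image_eqI[OF _ p(3)]) (rule left_module_hom_zero[OF assms(1-3), symmetric])
  next
    fix a b assume "a \<in> f ` P" "b \<in> f ` P"
    then obtain x y where "x \<in> P" "y \<in> P" "a = f x" "b = f y" by blast
    then show "a \<oplus>\<^bsub>N\<^esub> b \<in> f ` P" using h(2)[OF p(2) p(2)] p(4) by (intro image_eqI[of _ _ "x \<oplus>\<^bsub>M\<^esub> y"]) auto
  next
    fix r b assume r: "r \<in> carrier R" and "b \<in> f ` P"
    then obtain x where "x \<in> P" "b = f x" by blast
    then show "r \<odot>\<^bsub>N\<^esub> b \<in> f ` P"
      using h(3)[OF r p(2)] p(5)[OF r] by (intro image_eqI[of _ _ "r \<odot>\<^bsub>M\<^esub> x"]) auto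
  qed
qed

lemma submodule_vimage:
  assumes "left_module R M" "left_module R N" and f: "f \<in> left_module_hom R M N"
    and P: "submodule P R N"
  shows "submodule {x \<in> carrier M. f x \<in> P} R M"
proof -
  interpret M: left_module R M by fact
  interpret N: left_module R N by fact
  note p = N.submoduleD[OF P] and h = left_module_homD[OF f]
  show ?thesis
    by (rule M.submoduleI)
      (auto simp: left_module_hom_zero[OF assms(1-3)] h(2,3) p(3,4,5) M.smult_closed)
qed

text \<open>By \<open>ext\<close>, \<open>M\<close> is injective relative to itself.  The summand is a maximal submodule among those
  that contain \<open>B\<close> and whose nonzero submodules all contain \<open>v\<close>.\<close>

lemma (in left_module) monolithic_summand:
  assumes ext: "\<And>A f. \<lbrakk> submodule A R M; f \<in> left_module_hom R (M\<lparr>carrier := A\<rparr>) M \<rbrakk>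
      \<Longrightarrow> \<exists>g\<in>left_module_hom R M M. \<forall>x\<in>A. g x = f x"
    and B: "submodule B R M" and v: "v \<in> B"
    and mono: "\<And>Q. \<lbrakk> submodule Q R M; Q \<subseteq> B; Q \<noteq> {\<zero>\<^bsub>M\<^esub>} \<rbrakk> \<Longrightarrow> v \<in> Q"
  obtains E h where "submodule E R M" "B \<subseteq> E"
    "\<And>Q. \<lbrakk> submodule Q R M; Q \<subseteq> E; Q \<noteq> {\<zero>\<^bsub>M\<^esub>} \<rbrakk> \<Longrightarrow> v \<in> Q"
    "h \<in> left_module_hom R M (M\<lparr>carrier := E\<rparr>)" "\<And>e. e \<in> E \<Longrightarrow> h e = e"
proof -
  note LM = left_module_axioms
  define P where "P E \<longleftrightarrow> (\<forall>Q. submodule Q R M \<longrightarrow> Q \<subseteq> E \<longrightarrow> Q \<noteq> {\<zero>\<^bsub>M\<^esub>} \<longrightarrow> v \<in> Q)" for E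
  have PB: "P B" using mono by (auto simp: P_def)
  \<comment> \<open>A nonzero element of \<open>Q\<close> lies in some member \<open>N\<close> of
    the chain, so \<open>Q\<close> meets \<open>N\<close> nontrivially and the property of
    \<open>N\<close> applies to the intersection.\<close>
  have PU: "P (\<Union>C)" if C: "subset.chain {N. submodule N R M \<and> P N} C" for C
    unfolding P_def
  proof (intro allI impI)
    fix Q assume Q: "submodule Q R M" "Q \<subseteq> \<Union>C" "Q \<noteq> {\<zero>\<^bsub>M\<^esub>}"
    then obtain q where q: "q \<in> Q" "q \<noteq> \<zero>\<^bsub>M\<^esub>" using submoduleD(3)[OF Q(1)] by blast
    then obtain N where N: "N \<in> C" "q \<in> N" using Q(2) by blast
    then have N': "submodule N R M" "P N" using C by (auto simp: subset_chain_def)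
    have "submodule (Q \<inter> N) R M" "Q \<inter> N \<subseteq> N" "Q \<inter> N \<noteq> {\<zero>\<^bsub>M\<^esub>}"
      using submodule_Int[OF Q(1) N'(1)] q N by blast+
    then show "v \<in> Q" using N'(2) unfolding P_def by blast
  qed
  obtain E where E: "submodule E R M" "P E" "B \<subseteq> E"
    and max: "\<And>N. \<lbrakk> submodule N R M; P N; E \<subseteq> N \<rbrakk> \<Longrightarrow> N = E"
    by (rule maximal_submodule[OF B, of P]) (use PB PU in auto)
  note e = submoduleD[OF E(1)]
  \<comment> \<open>\<open>C\<close> is a trial complement: the projection from \<open>E + C\<close>
    to \<open>E\<close> extends to an endomorphism \<open>g\<close> of \<open>M\<close>, and the aim
    is to show that the image of \<open>g\<close> is no larger than \<open>E\<close>.\<close>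
  obtain C where C: "submodule C R M" "C \<inter> (E - {\<zero>\<^bsub>M\<^esub>}) = {}"
    and maxC: "\<And>P. \<lbrakk> submodule P R M; P \<inter> (E - {\<zero>\<^bsub>M\<^esub>}) = {}; C \<subseteq> P \<rbrakk> \<Longrightarrow> P = C"
    by (rule maximal_submodule_avoiding[OF zero_submodule, of "E - {\<zero>\<^bsub>M\<^esub>}"]) auto
  note c = submoduleD[OF C(1)]
  have EC: "E \<inter> C = {\<zero>\<^bsub>M\<^esub>}" using C(2) e(3) c(3) by blast
  obtain p where p: "p \<in> left_module_hom R (M\<lparr>carrier := E <+>\<^bsub>M\<^esub> C\<rparr>) (M\<lparr>carrier := E\<rparr>)"
    "\<And>a. a \<in> E \<Longrightarrow> p a = a" "\<And>c. c \<in> C \<Longrightarrow> p c = \<zero>\<^bsub>M\<^esub>"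
    using projection_hom[OF E(1) C(1) EC] by blast
  have "p \<in> left_module_hom R (M\<lparr>carrier := E <+>\<^bsub>M\<^esub> C\<rparr>) M"
    using p(1) e(1) by (auto simp: left_module_hom_def)
  then obtain g where g: "g \<in> left_module_hom R M M"
    and gp: "\<And>x. x \<in> E <+>\<^bsub>M\<^esub> C \<Longrightarrow> g x = p x"
    using ext[OF submodule_set_add(1)[OF E(1) C(1)]] by blast
  have gE: "g a = a" if "a \<in> E" for a
    using that gp p(2) submodule_set_add(2)[OF E(1) C(1)] by auto
  have gC: "g a = \<zero>\<^bsub>M\<^esub>" if "a \<in> C" for a
    using that gp p(3) submodule_set_add(3)[OF E(1) C(1)] by auto
  let ?I = "g ` carrier M"
  have I: "submodule ?I R M" by (rule submodule_image[OF LM LM g carrier_submodule])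
  have "E \<subseteq> ?I" using gE e(2) by (metis imageI subsetI)
  moreover have "P ?I"
    unfolding P_def
  proof (intro allI impI)
    fix Q assume Q: "submodule Q R M" "Q \<subseteq> ?I" "Q \<noteq> {\<zero>\<^bsub>M\<^esub>}"
    \<comment> \<open>The preimage of \<open>Q\<close> contains \<open>C\<close>, which
      \<open>g\<close> kills, and does so strictly because \<open>Q\<close> is nonzero. By
      maximality of \<open>C\<close> it meets \<open>E\<close> nontrivially, so it contains
      \<open>v\<close>, and \<open>g v = v\<close>.\<close>
    let ?T = "{x \<in> carrier M. g x \<in> Q}"
    have T: "submodule ?T R M" by (rule submodule_vimage[OF LM LM g Q(1)])
    have "C \<subseteq> ?T" using c(2) gC submoduleD(3)[OF Q(1)] by auto
    moreover obtain q where q: "q \<in> Q" "q \<noteq> \<zero>\<^bsub>M\<^esub>" using Q(3) submoduleD(3)[OF Q(1)] by blast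
    then obtain y where "y \<in> carrier M" "q = g y" using Q(2) by blast
    then have "y \<in> ?T" "y \<notin> C" using q gC by auto
    ultimately have "?T \<inter> (E - {\<zero>\<^bsub>M\<^esub>}) \<noteq> {}" using maxC[OF T] by blast
    then have "?T \<inter> E \<noteq> {\<zero>\<^bsub>M\<^esub>}" by blast
    then have "v \<in> ?T \<inter> E" using E(2) submodule_Int[OF T E(1)] unfolding P_def by blast
    then show "v \<in> Q" using gE by auto
  qed
  ultimately have "?I = E" using max[OF I] by blast
  then have "g \<in> left_module_hom R M (M\<lparr>carrier := E\<rparr>)"
    using g by (auto simp: left_module_hom_def)
  then show thesis using E gE by (intro that[of E g]) (auto simp: P_def)
qed

section \<open>Coinduced modules\<close>

text \<open>This is Hom over \<open>F\<close> from \<open>S\<close> to \<open>D\<close>. Multiplying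
  the argument from the right makes it a left \<open>S\<close>-module, and preserves
  \<open>F\<close>-linearity because left and right multiplications commute. Extensionality makes
  maps that agree on \<open>S\<close> equal. If the elements of \<open>D\<close> are cosets in
  \<open>S\<close>, the element type is the one that \<open>diamond\<close> prescribes.\<close>

definition coinduced_module ::
  "('s, 'c) ring_scheme \<Rightarrow> 's set \<Rightarrow> ('s, 'b, 'd) module_scheme \<Rightarrow> ('s, 's \<Rightarrow> 'b) module" where
  "coinduced_module S F D =
    \<lparr>carrier = left_module_hom (S\<lparr>carrier := F\<rparr>) (regular_module S) D \<inter> extensional (carrier S),
     monoid.mult = undefined, one = undefined,
     ring.zero = (\<lambda>t\<in>carrier S. \<zero>\<^bsub>D\<^esub>),
     add = (\<lambda>f g. \<lambda>t\<in>carrier S. f t \<oplus>\<^bsub>D\<^esub> g t),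
     smult = (\<lambda>s f. \<lambda>t\<in>carrier S. f (t \<otimes>\<^bsub>S\<^esub> s))\<rparr>"

section \<open>The regular module and restriction of scalars\<close>

lemma regular_module_simps [simp]:
  "carrier (regular_module S) = carrier S" "\<zero>\<^bsub>regular_module S\<^esub> = \<zero>\<^bsub>S\<^esub>"
  "a \<oplus>\<^bsub>regular_module S\<^esub> b = a \<oplus>\<^bsub>S\<^esub> b" "a \<odot>\<^bsub>regular_module S\<^esub> b = a \<otimes>\<^bsub>S\<^esub> b"
  by (simp_all add: regular_module_def)

lemma regular_module_a_inv [simp]: "\<ominus>\<^bsub>regular_module S\<^esub> a = \<ominus>\<^bsub>S\<^esub> a"
  by (simp add: a_inv_def regular_module_def m_inv_def)

lemma regular_module_minus [simp]: "a \<ominus>\<^bsub>regular_module S\<^esub> b = a \<ominus>\<^bsub>S\<^esub> b"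
  by (simp add: a_minus_def)

lemma regular_left_module:
  assumes "ring S"
  shows "left_module S (regular_module S)"
proof -
  interpret ring S by fact
  show ?thesis
  proof (intro left_module.intro left_module_axioms.intro ring_axioms)
    show "abelian_group (regular_module S)"
    proof (rule abelian_groupI)
      fix x assume "x \<in> carrier (regular_module S)"
      then show "\<exists>y\<in>carrier (regular_module S). y \<oplus>\<^bsub>regular_module S\<^esub> x = \<zero>\<^bsub>regular_module S\<^esub>"
        using l_neg[of x] a_inv_closed[of x] by auto
    qed (auto simp: a_ac)
  qed (simp_all add: l_distr r_distr m_assoc)
qed

lemma restrict_scalars:
  assumes "left_module S B" "subring F S"
  shows "left_module (S\<lparr>carrier := F\<rparr>) B"
proof -
  interpret B: left_module S B by fact
  have "F \<subseteq> carrier S" using subringE(1)[OF assms(2)] .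
  then show ?thesis
    by (intro left_module.intro left_module_axioms.intro B.R.subring_is_ring assms(2)
        B.M.abelian_group_axioms)
      (auto simp: B.smult_closed B.smult_l_distr B.smult_r_distr B.smult_assoc1 B.smult_one subset_iff)
qed

lemma submodule_restrict_scalars:
  assumes "left_module S B" "subring F S" "submodule A S B"
  shows "submodule A (S\<lparr>carrier := F\<rparr>) B"
proof -
  interpret B: left_module S B by fact
  interpret F: left_module "S\<lparr>carrier := F\<rparr>" B by (rule restrict_scalars) fact+
  show ?thesis
    using B.submoduleD(1,3,4,5)[OF assms(3)] subringE(1)[OF assms(2)]
    by (intro F.submoduleI) (simp_all add: subset_iff)
qed

locale coinduction = S?: ring S + D?: left_module "S\<lparr>carrier := F\<rparr>" D
  for S :: "('s, 'c) ring_scheme" and F and D :: "('s, 'b, 'd) module_scheme" +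
  assumes F: "subring F S"
begin

abbreviation "E \<equiv> coinduced_module S F D"

lemma F_carrier: "q \<in> F \<Longrightarrow> q \<in> carrier S"
  using subringE(1)[OF F] by blast

lemma coinduced_iff:
  "f \<in> carrier E \<longleftrightarrow> f \<in> extensional (carrier S) \<and> (\<forall>x\<in>carrier S. f x \<in> carrier D) \<and>
    (\<forall>x\<in>carrier S. \<forall>y\<in>carrier S. f (x \<oplus>\<^bsub>S\<^esub> y) = f x \<oplus>\<^bsub>D\<^esub> f y) \<and>
    (\<forall>q\<in>F. \<forall>x\<in>carrier S. f (q \<otimes>\<^bsub>S\<^esub> x) = q \<odot>\<^bsub>D\<^esub> f x)"
  by (auto simp: coinduced_module_def left_module_hom_def)

lemma coinducedI:
  assumes "\<And>x. x \<in> carrier S \<Longrightarrow> f x \<in> carrier D"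
    and "\<And>x y. x \<in> carrier S \<Longrightarrow> y \<in> carrier S \<Longrightarrow> f (x \<oplus>\<^bsub>S\<^esub> y) = f x \<oplus>\<^bsub>D\<^esub> f y"
    and "\<And>q x. q \<in> F \<Longrightarrow> x \<in> carrier S \<Longrightarrow> f (q \<otimes>\<^bsub>S\<^esub> x) = q \<odot>\<^bsub>D\<^esub> f x"
  shows "restrict f (carrier S) \<in> carrier E"
  using assms by (simp add: coinduced_iff F_carrier)

lemma coinducedD:
  assumes "f \<in> carrier E"
  shows "f \<in> extensional (carrier S)"
    and "\<And>x. x \<in> carrier S \<Longrightarrow> f x \<in> carrier D"
    and "\<And>x y. x \<in> carrier S \<Longrightarrow> y \<in> carrier S \<Longrightarrow> f (x \<oplus>\<^bsub>S\<^esub> y) = f x \<oplus>\<^bsub>D\<^esub> f y"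
    and "\<And>q x. q \<in> F \<Longrightarrow> x \<in> carrier S \<Longrightarrow> f (q \<otimes>\<^bsub>S\<^esub> x) = q \<odot>\<^bsub>D\<^esub> f x"
  using assms by (simp_all add: coinduced_iff)

lemma coinduced_simps:
  "\<zero>\<^bsub>E\<^esub> = (\<lambda>t\<in>carrier S. \<zero>\<^bsub>D\<^esub>)"
  "f \<oplus>\<^bsub>E\<^esub> g = (\<lambda>t\<in>carrier S. f t \<oplus>\<^bsub>D\<^esub> g t)"
  "s \<odot>\<^bsub>E\<^esub> f = (\<lambda>t\<in>carrier S. f (t \<otimes>\<^bsub>S\<^esub> s))"
  by (simp_all add: coinduced_module_def)

lemma D_smult: "q \<in> F \<Longrightarrow> y \<in> carrier D \<Longrightarrow> q \<odot>\<^bsub>D\<^esub> y \<in> carrier D"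
  using D.smult_closed by simp

lemma coinduced_left_module: "left_module S E"
proof (intro left_module.intro left_module_axioms.intro S.ring_axioms)
  show "abelian_group E"
  proof (rule abelian_groupI)
    show "\<zero>\<^bsub>E\<^esub> \<in> carrier E"
      unfolding coinduced_simps by (rule coinducedI) (use D.smult_r_zero in auto)
    fix f assume f: "f \<in> carrier E"
    note f = coinducedD[OF f]
    show "\<zero>\<^bsub>E\<^esub> \<oplus>\<^bsub>E\<^esub> f = f"
      by (rule extensionalityI[OF _ f(1)]) (auto simp: coinduced_simps f)
    show "\<exists>g\<in>carrier E. g \<oplus>\<^bsub>E\<^esub> f = \<zero>\<^bsub>E\<^esub>"
    proof (rule bexI)
      have neg: "\<ominus>\<^bsub>D\<^esub> (q \<odot>\<^bsub>D\<^esub> y) = q \<odot>\<^bsub>D\<^esub> (\<ominus>\<^bsub>D\<^esub> y)" if "q \<in> F" "y \<in> carrier D" for q y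
      proof (rule D.M.minus_equality)
        show "q \<odot>\<^bsub>D\<^esub> (\<ominus>\<^bsub>D\<^esub> y) \<oplus>\<^bsub>D\<^esub> q \<odot>\<^bsub>D\<^esub> y = \<zero>\<^bsub>D\<^esub>"
          using that D.smult_r_distr[of q "\<ominus>\<^bsub>D\<^esub> y" y] D.smult_r_zero[of q] by (simp add: D.M.l_neg)
      qed (use that D_smult in auto)
      show "(\<lambda>t\<in>carrier S. \<ominus>\<^bsub>D\<^esub> f t) \<in> carrier E"
        by (rule coinducedI) (auto simp: f D.M.minus_add neg)
      show "(\<lambda>t\<in>carrier S. \<ominus>\<^bsub>D\<^esub> f t) \<oplus>\<^bsub>E\<^esub> f = \<zero>\<^bsub>E\<^esub>"
        by (auto simp: coinduced_simps f D.M.l_neg intro: restrict_ext)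
    qed
    fix g assume g: "g \<in> carrier E"
    note g = coinducedD[OF g]
    show "f \<oplus>\<^bsub>E\<^esub> g \<in> carrier E"
      unfolding coinduced_simps
      by (rule coinducedI) (use D.smult_r_distr in \<open>auto simp: f g D.M.a_ac\<close>)
    show "f \<oplus>\<^bsub>E\<^esub> g = g \<oplus>\<^bsub>E\<^esub> f"
      by (auto simp: coinduced_simps f g D.M.a_ac intro!: restrict_ext)
    fix h assume h: "h \<in> carrier E"
    note h = coinducedD[OF h]
    show "f \<oplus>\<^bsub>E\<^esub> g \<oplus>\<^bsub>E\<^esub> h = f \<oplus>\<^bsub>E\<^esub> (g \<oplus>\<^bsub>E\<^esub> h)"
      by (auto simp: coinduced_simps f g h D.M.a_ac intro!: restrict_ext)
  qed
  fix f assume f: "f \<in> carrier E"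
  note f = coinducedD[OF f]
  show "\<one>\<^bsub>S\<^esub> \<odot>\<^bsub>E\<^esub> f = f"
    by (rule extensionalityI[OF _ f(1)]) (auto simp: coinduced_simps)
  fix a assume a: "a \<in> carrier S"
  show "a \<odot>\<^bsub>E\<^esub> f \<in> carrier E"
    unfolding coinduced_simps using a
    by (intro coinducedI) (auto simp: f S.l_distr S.m_assoc F_carrier)
  { fix b assume b: "b \<in> carrier S"
    show "(a \<oplus>\<^bsub>S\<^esub> b) \<odot>\<^bsub>E\<^esub> f = a \<odot>\<^bsub>E\<^esub> f \<oplus>\<^bsub>E\<^esub> b \<odot>\<^bsub>E\<^esub> f"
      using a b by (auto simp: coinduced_simps f S.r_distr intro!: restrict_ext)
    show "(a \<otimes>\<^bsub>S\<^esub> b) \<odot>\<^bsub>E\<^esub> f = a \<odot>\<^bsub>E\<^esub> (b \<odot>\<^bsub>E\<^esub> f)"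
      using a b by (auto simp: coinduced_simps f S.m_assoc intro!: restrict_ext) }
  fix g assume g: "g \<in> carrier E"
  note g = coinducedD[OF g]
  show "a \<odot>\<^bsub>E\<^esub> (f \<oplus>\<^bsub>E\<^esub> g) = a \<odot>\<^bsub>E\<^esub> f \<oplus>\<^bsub>E\<^esub> a \<odot>\<^bsub>E\<^esub> g"
    using a by (auto simp: coinduced_simps f g intro!: restrict_ext)
qed

text \<open>A homomorphism \<open>f\<close> into the coinduced module is determined by the \<open>F\<close>-linear map
  \<open>\<lambda>b. f b \<one>\<close>.\<close>

lemma coinduced_hom_extension:
  assumes skew: "skew_field (S\<lparr>carrier := F\<rparr>)" and B: "left_module S B" and A: "submodule A S B"
    and f: "f \<in> left_module_hom S (B\<lparr>carrier := A\<rparr>) E"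
  shows "\<exists>g\<in>left_module_hom S B E. \<forall>x\<in>A. g x = f x"
proof -
  interpret B: left_module S B by fact
  note a = B.submoduleD[OF A]
  note f = left_module_homD[OF f, simplified]
  have "(\<lambda>b. f b \<one>\<^bsub>S\<^esub>) \<in> left_module_hom (S\<lparr>carrier := F\<rparr>) (B\<lparr>carrier := A\<rparr>) D"
  proof (rule left_module_homI; simp)
    fix x assume x: "x \<in> A"
    then show "f x \<one>\<^bsub>S\<^esub> \<in> carrier D" using coinducedD(2)[OF f(1)] by simp
    show "f (x \<oplus>\<^bsub>B\<^esub> y) \<one>\<^bsub>S\<^esub> = f x \<one>\<^bsub>S\<^esub> \<oplus>\<^bsub>D\<^esub> f y \<one>\<^bsub>S\<^esub>" if "y \<in> A" for y
      using x that by (simp add: f(2) coinduced_simps)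
    fix q assume q: "q \<in> F"
    then show "f (q \<odot>\<^bsub>B\<^esub> x) \<one>\<^bsub>S\<^esub> = q \<odot>\<^bsub>D\<^esub> f x \<one>\<^bsub>S\<^esub>"
      using x coinducedD(4)[OF f(1)[OF x] q, of "\<one>\<^bsub>S\<^esub>"] by (simp add: f(3) coinduced_simps F_carrier)
  qed
  then obtain g where g: "g \<in> left_module_hom (S\<lparr>carrier := F\<rparr>) B D"
    and gf: "\<And>x. x \<in> A \<Longrightarrow> g x = f x \<one>\<^bsub>S\<^esub>"
    using skew_field_hom_extension[OF skew restrict_scalars[OF B F] submodule_restrict_scalars[OF B F A]]
    by blast
  note g = left_module_homD[OF g, simplified]
  \<comment> \<open>Since \<open>f b t\<close> is the value of \<open>t (f b) = f (t b)\<close> at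
    \<open>1\<close>, the map into the coinduced module is recovered from its values at
    \<open>1\<close> by this formula.\<close>
  let ?g = "\<lambda>b. \<lambda>t\<in>carrier S. g (t \<odot>\<^bsub>B\<^esub> b)"
  show ?thesis
  proof (rule bexI)
    show "\<forall>x\<in>A. ?g x = f x"
    proof
      fix x assume x: "x \<in> A"
      show "?g x = f x"
      proof (rule extensionalityI[OF _ coinducedD(1)[OF f(1)[OF x]]])
        fix t assume t: "t \<in> carrier S"
        then show "?g x t = f x t" using x by (simp add: gf a(5) f(3) coinduced_simps)
      qed simp
    qed
    show "?g \<in> left_module_hom S B E"
    proof (rule left_module_homI)
      fix b assume b: "b \<in> carrier B"
      show "?g b \<in> carrier E"
        by (rule coinducedI)
          (use b in \<open>auto simp: g(1) B.smult_closed B.smult_l_distr B.smult_assoc1 F_carrier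
             g(2) g(3)[symmetric]\<close>)
      show "?g (b \<oplus>\<^bsub>B\<^esub> c) = ?g b \<oplus>\<^bsub>E\<^esub> ?g c" if "c \<in> carrier B" for c
        using b that by (auto simp: coinduced_simps B.smult_r_distr B.smult_closed g(2) intro!: restrict_ext)
      show "?g (r \<odot>\<^bsub>B\<^esub> b) = r \<odot>\<^bsub>E\<^esub> ?g b" if "r \<in> carrier S" for r
        using b that by (auto simp: coinduced_simps B.smult_assoc1 intro!: restrict_ext)
    qed
  qed
qed

end

section \<open>Descending chains above a left ideal\<close>

text \<open>For submodules \<open>N \<subseteq> P\<close> this says that \<open>P/N\<close> is
  Artinian, without forming the quotient: its submodules correspond to those between
  \<open>N\<close> and \<open>P\<close>. All chains then live in one type, and different
  \<open>N\<close> can be compared directly.\<close>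

definition dcc_between ::
  "('a, 'c) ring_scheme \<Rightarrow> ('a, 'b, 'd) module_scheme \<Rightarrow> 'b set \<Rightarrow> 'b set \<Rightarrow> bool" where
  "dcc_between R M N P \<longleftrightarrow>
     (\<forall>J :: nat \<Rightarrow> 'b set. (\<forall>i. submodule (J i) R M \<and> N \<subseteq> J i \<and> J i \<subseteq> P \<and> J (Suc i) \<subseteq> J i) \<longrightarrow>
        (\<exists>k. \<forall>i\<ge>k. J i = J k))"

lemma dcc_betweenI:
  assumes "\<And>J :: nat \<Rightarrow> 'b set. \<lbrakk> \<And>i. submodule (J i) R M; \<And>i. N \<subseteq> J i; \<And>i. J i \<subseteq> P;
      \<And>i. J (Suc i) \<subseteq> J i \<rbrakk> \<Longrightarrow> \<exists>k. \<forall>i\<ge>k. J i = J k"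
  shows "dcc_between R M N P"
  unfolding dcc_between_def by (intro allI impI, rule assms) auto

lemma dcc_betweenD:
  assumes "dcc_between R M N P" "\<And>i. submodule (J i) R M" "\<And>i. N \<subseteq> J i" "\<And>i. J i \<subseteq> P"
    "\<And>i. J (Suc i) \<subseteq> J i"
  obtains k where "\<And>i. i \<ge> k \<Longrightarrow> J i = J k"
proof -
  have "\<exists>k. \<forall>i\<ge>k. J i = J k" using assms unfolding dcc_between_def by simp
  then show thesis using that by blast
qed

lemma dcc_between_refl: "dcc_between R M N N"
  by (rule dcc_betweenI) (metis subset_antisym)

lemma artinian_moduleD:
  fixes J :: "nat \<Rightarrow> 'b set"
  assumes "artinian_module R M" "\<And>i. submodule (J i) R M" "\<And>i. J (Suc i) \<subseteq> J i"
  shows "\<exists>k. \<forall>i\<ge>k. J i = J k"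
  using assms unfolding artinian_module_def by simp

lemma dcc_between_mono: "dcc_between R M N P \<Longrightarrow> N \<subseteq> N' \<Longrightarrow> dcc_between R M N' P"
  unfolding dcc_between_def by (meson subset_trans)

text \<open>Without a minimal member, dependent choice would produce a strictly descending sequence
  in \<open>\<A>\<close>.\<close>

lemma dcc_between_minimal:
  assumes dcc: "dcc_between R M N P" and ne: "\<A> \<noteq> {}"
    and sub: "\<And>J. J \<in> \<A> \<Longrightarrow> submodule J R M \<and> N \<subseteq> J \<and> J \<subseteq> P"
  obtains J where "J \<in> \<A>" "\<And>I. I \<in> \<A> \<Longrightarrow> I \<subseteq> J \<Longrightarrow> I = J"
proof (rule ccontr)
  assume no: "\<not> thesis"
  have ex: "\<exists>I. I \<in> \<A> \<and> I \<subset> J" if "J \<in> \<A>" for J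
    using that no \<open>\<And>J. \<lbrakk> J \<in> \<A>; \<And>I. I \<in> \<A> \<Longrightarrow> I \<subseteq> J \<Longrightarrow> I = J \<rbrakk> \<Longrightarrow> thesis\<close> by blast
  have "\<exists>f. \<forall>n. f n \<in> \<A> \<and> f (Suc n) \<subset> f n"
    by (rule dependent_nat_choice) (use ne ex in auto)
  then obtain f where f: "\<And>n. f n \<in> \<A>" "\<And>n. f (Suc n) \<subset> f n" by blast
  obtain k where "\<And>i. i \<ge> k \<Longrightarrow> f i = f k"
    using dcc_betweenD[OF dcc, of f] sub[OF f(1)] f(2) by blast
  from this[of "Suc k"] show False using f(2)[of k] by auto
qed

context left_module
begin

text \<open>The modular law: write \<open>y\<close> in \<open>J\<close> as \<open>u + v\<close> with
  \<open>u\<close> in \<open>I\<close> and \<open>v\<close> in \<open>P\<close>; then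
  \<open>v = y - u\<close> lies in \<open>J \<inter> P\<close>, hence in \<open>I\<close>.\<close>

lemma submodule_eqI_modular:
  assumes J: "submodule J R M" and I: "submodule I R M" and P: "submodule P R M"
    and "I \<subseteq> J" "J \<inter> P \<subseteq> I" "J \<subseteq> I <+>\<^bsub>M\<^esub> P"
  shows "I = J"
proof
  show "J \<subseteq> I"
  proof
    fix y assume y: "y \<in> J"
    then obtain u v where uv: "u \<in> I" "v \<in> P" "y = u \<oplus>\<^bsub>M\<^esub> v" using assms(6) by (blast elim: set_addE)
    then have "y \<ominus>\<^bsub>M\<^esub> u = v"
      using submoduleD(2)[OF I uv(1)] submoduleD(2)[OF P uv(2)] M.add.m_comm[of u v]
      by (simp add: M.minus_eq M.add.m_assoc M.r_neg)
    moreover have "y \<ominus>\<^bsub>M\<^esub> u \<in> J" using submoduleD(7)[OF J y] uv(1) assms(4) by blast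
    ultimately have "v \<in> I" using uv(2) assms(5) by blast
    then show "y \<in> I" using submoduleD(4)[OF I uv(1)] uv(3) by simp
  qed
qed fact

text \<open>In \<open>M/(N \<inter> N')\<close> the submodule \<open>N/(N \<inter> N')\<close>
  embeds into \<open>M/N'\<close>, and the quotient by it is \<open>M/N\<close>. So a chain
  \<open>J i\<close> is controlled by \<open>J i + N\<close> above \<open>N\<close> and by
  \<open>(J i \<inter> N) + N'\<close> above \<open>N'\<close>, both of which become
  stationary.\<close>

lemma dcc_between_Int:
  assumes N: "submodule N R M" and N': "submodule N' R M"
    and dcc: "dcc_between R M N (carrier M)" and dcc': "dcc_between R M N' (carrier M)"
  shows "dcc_between R M (N \<inter> N') (carrier M)"
proof (rule dcc_betweenI)
  fix J :: "nat \<Rightarrow> 'b set"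
  assume J: "\<And>i. submodule (J i) R M" "\<And>i. N \<inter> N' \<subseteq> J i" "\<And>i. J i \<subseteq> carrier M"
    and dec: "\<And>i. J (Suc i) \<subseteq> J i"
  have le: "J i \<subseteq> J k" if "k \<le> i" for i k using that dec by (rule lift_Suc_antimono_le[rotated])
  have mono: "A <+>\<^bsub>M\<^esub> B \<subseteq> A' <+>\<^bsub>M\<^esub> B" if "A \<subseteq> A'" for A A' B
    using that by (blast elim: set_addE intro: set_addI)
  note JN = submodule_Int[OF J(1) N]
  obtain k where k: "\<And>i. i \<ge> k \<Longrightarrow> J i <+>\<^bsub>M\<^esub> N = J k <+>\<^bsub>M\<^esub> N"
    using dcc_betweenD[OF dcc, of "\<lambda>i. J i <+>\<^bsub>M\<^esub> N"] submodule_set_add[OF J(1) N] mono[OF dec]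
      submoduleD(1)[OF submodule_set_add(1)[OF J(1) N]] by blast
  obtain l where l: "\<And>i. i \<ge> l \<Longrightarrow> (J i \<inter> N) <+>\<^bsub>M\<^esub> N' = (J l \<inter> N) <+>\<^bsub>M\<^esub> N'"
  proof (rule dcc_betweenD[OF dcc', of "\<lambda>i. (J i \<inter> N) <+>\<^bsub>M\<^esub> N'"])
    fix i
    show "(J (Suc i) \<inter> N) <+>\<^bsub>M\<^esub> N' \<subseteq> (J i \<inter> N) <+>\<^bsub>M\<^esub> N'" using dec by (intro mono) auto
  qed (use submodule_set_add[OF JN N'] submoduleD(1)[OF submodule_set_add(1)[OF JN N']] in auto)
  have "J i = J (max k l)" if i: "i \<ge> max k l" for i
  proof (rule submodule_eqI_modular[OF J(1) J(1) N le[OF i]])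
    let ?m = "max k l"
    \<comment> \<open>Every \<open>J i \<inter> N\<close> meets \<open>N'\<close> exactly in
      \<open>N \<inter> N'\<close>, so the modular law recovers it from its sum with
      \<open>N'\<close>.\<close>
    have "J i \<inter> N = J ?m \<inter> N"
    proof (rule submodule_eqI_modular[OF JN JN N'])
      show "J ?m \<inter> N \<subseteq> (J i \<inter> N) <+>\<^bsub>M\<^esub> N'"
        using l[of i] l[of ?m] i submodule_set_add(2)[OF JN N', of ?m] by auto
    qed (use le[OF i] J(2) in auto)
    then show "J ?m \<inter> N \<subseteq> J i" by blast
    show "J ?m \<subseteq> J i <+>\<^bsub>M\<^esub> N"
      using k[of i] k[of ?m] i submodule_set_add(2)[OF J(1) N, of ?m] by auto
  qed
  then show "\<exists>k. \<forall>i\<ge>k. J i = J k" by blast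
qed

end

text \<open>A submodule above \<open>N\<close> is determined by its cosets, so a chain above
  \<open>N\<close> is stationary as soon as its image in the quotient is.\<close>

lemma (in left_module) artinian_quotient_dcc:
  assumes N: "submodule N R M" and art: "artinian_module R (quotient_module M N)"
  shows "dcc_between R M N (carrier M)"
proof (rule dcc_betweenI)
  let ?\<pi> = "\<lambda>x. N +>\<^bsub>M\<^esub> x"
  fix J :: "nat \<Rightarrow> 'b set"
  assume J: "\<And>i. submodule (J i) R M" "\<And>i. N \<subseteq> J i" "\<And>i. J (Suc i) \<subseteq> J i"
  note LQ = quotient_left_module[OF N]
  have "?\<pi> \<in> left_module_hom R M (quotient_module M N)"
    by (rule left_module_homI)
      (simp_all add: carrier_quotient[OF N] add_quotient[OF N] smult_quotient[OF N])
  then have I: "submodule (?\<pi> ` J i) R (quotient_module M N)" for i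
    using submodule_image[OF left_module_axioms LQ _ J(1)] by blast
  obtain k where k: "\<forall>i\<ge>k. ?\<pi> ` J i = ?\<pi> ` J k"
    using artinian_moduleD[OF art, of "\<lambda>i. ?\<pi> ` J i", OF I image_mono[OF J(3)]] ..
  have "J k \<subseteq> J i" if i: "i \<ge> k" for i
  proof
    fix x assume x: "x \<in> J k"
    then obtain y where y: "y \<in> J i" "?\<pi> x = ?\<pi> y" using k i by blast
    have xy: "x \<in> carrier M" "y \<in> carrier M"
      using submoduleD(2)[OF J(1) x] submoduleD(2)[OF J(1) y(1)] .
    then have "x \<ominus>\<^bsub>M\<^esub> y \<in> J i" using y(2) coset_eq_iff[OF N] J(2) by blast
    then have "(x \<ominus>\<^bsub>M\<^esub> y) \<oplus>\<^bsub>M\<^esub> y \<in> J i" using submoduleD(4)[OF J(1)] y(1) by blast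
    then show "x \<in> J i" using xy by (simp add: M.minus_eq M.add.m_assoc M.l_neg)
  qed
  moreover have "J i \<subseteq> J k" if "i \<ge> k" for i
    using that J(3) by (rule lift_Suc_antimono_le[rotated])
  ultimately show "\<exists>k. \<forall>i\<ge>k. J i = J k" by blast
qed

section \<open>Principal left ideals and right multiplication\<close>

lemma submodule_principal_left_ideal:
  assumes "ring S" "p \<in> carrier S"
  shows "submodule (principal_left_ideal S p) S (regular_module S)"
proof -
  interpret left_module S "regular_module S" by (rule regular_left_module[OF assms(1)])
  have "principal_left_ideal S p = cyclic p" by (simp add: principal_left_ideal_def cyclic_def)
  then show ?thesis using submodule_cyclic[of p] assms(2) by simp
qed

lemma principal_left_idealI: "s \<in> carrier S \<Longrightarrow> s \<otimes>\<^bsub>S\<^esub> p \<in> principal_left_ideal S p"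
  unfolding principal_left_ideal_def by blast

lemma principal_left_idealE:
  assumes "y \<in> principal_left_ideal S p"
  obtains s where "s \<in> carrier S" "y = s \<otimes>\<^bsub>S\<^esub> p"
  using assms unfolding principal_left_ideal_def by blast

text \<open>Right multiplication by \<open>q\<close> is a homomorphism from \<open>S\<close> onto
  \<open>S q\<close> that sends \<open>S p\<close> into \<open>S p q\<close>. Chains between
  \<open>S p q\<close> and \<open>S q\<close> therefore pull back to chains above
  \<open>S p\<close>, and each \<open>J i\<close>, being contained in \<open>S q\<close>, is the
  image of its preimage.\<close>

lemma dcc_right_multiple:
  assumes "ring S" and p: "p \<in> carrier S" and q: "q \<in> carrier S"
    and dcc: "dcc_between S (regular_module S) (principal_left_ideal S p) (carrier S)"
  shows "dcc_between S (regular_module S) (principal_left_ideal S (p \<otimes>\<^bsub>S\<^esub> q)) (principal_left_ideal S q)"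
proof (rule dcc_betweenI)
  interpret ring S by fact
  note LS = regular_left_module[OF assms(1)]
  interpret L: left_module S "regular_module S" by (rule LS)
  fix J :: "nat \<Rightarrow> 'a set"
  assume J: "\<And>i. submodule (J i) S (regular_module S)"
    "\<And>i. principal_left_ideal S (p \<otimes>\<^bsub>S\<^esub> q) \<subseteq> J i" "\<And>i. J i \<subseteq> principal_left_ideal S q"
    "\<And>i. J (Suc i) \<subseteq> J i"
  have hom: "(\<lambda>s. s \<otimes>\<^bsub>S\<^esub> q) \<in> left_module_hom S (regular_module S) (regular_module S)"
    using q by (intro left_module_homI) (simp_all add: l_distr m_assoc)
  let ?I = "\<lambda>i. {s \<in> carrier S. s \<otimes>\<^bsub>S\<^esub> q \<in> J i}"
  have I: "submodule (?I i) S (regular_module S)" for i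
    using submodule_vimage[OF LS LS hom J(1)] by simp
  have pI: "principal_left_ideal S p \<subseteq> ?I i" for i
  proof
    fix y assume "y \<in> principal_left_ideal S p"
    then obtain s where s: "s \<in> carrier S" "y = s \<otimes>\<^bsub>S\<^esub> p" by (rule principal_left_idealE)
    then have "y \<otimes>\<^bsub>S\<^esub> q = s \<otimes>\<^bsub>S\<^esub> (p \<otimes>\<^bsub>S\<^esub> q)" using p q by (simp add: m_assoc)
    then show "y \<in> ?I i" using principal_left_idealI[OF s(1), of "p \<otimes>\<^bsub>S\<^esub> q"] J(2) s p by auto
  qed
  obtain k where k: "\<And>i. i \<ge> k \<Longrightarrow> ?I i = ?I k"
  proof (rule dcc_betweenD[OF dcc I pI])
    show "?I (Suc i) \<subseteq> ?I i" for i using J(4)[of i] by blast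
  qed auto
  have *: "J i = (\<lambda>s. s \<otimes>\<^bsub>S\<^esub> q) ` ?I i" for i
    using J(3)[of i] unfolding principal_left_ideal_def by blast
  have "J i = J k" if "i \<ge> k" for i
  proof -
    have "J i = (\<lambda>s. s \<otimes>\<^bsub>S\<^esub> q) ` ?I i" by (rule *)
    also have "\<dots> = (\<lambda>s. s \<otimes>\<^bsub>S\<^esub> q) ` ?I k" by (simp only: k[OF that])
    also have "\<dots> = J k" by (rule *[symmetric])
    finally show ?thesis .
  qed
  then show "\<exists>k. \<forall>i\<ge>k. J i = J k" by blast
qed

section \<open>Consequences of property \<open>(\<diamond>)\<close>\<close>

text \<open>Here \<open>S/N\<close> has a smallest nonzero submodule, generated by the class of \<open>w\<close>.  It embeds into the
  injective module coinduced from \<open>S/N\<close> by sending the class of \<open>s\<close> to \<open>\<lambda>t. t s + N\<close>.\<close>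

lemma diamond_monolithic_dcc:
  assumes "ring S" and sub: "subring F S" and skew: "skew_field (S\<lparr>carrier := F\<rparr>)" and "diamond S"
    and N: "submodule N S (regular_module S)" and w: "w \<in> carrier S" "w \<notin> N"
    and mono: "\<And>J. \<lbrakk> submodule J S (regular_module S); N \<subseteq> J; J \<noteq> N \<rbrakk> \<Longrightarrow> w \<in> J"
  shows "dcc_between S (regular_module S) N (carrier S)"
proof -
  interpret S: ring S by fact
  note LS = regular_left_module[OF \<open>ring S\<close>]
  interpret L: left_module S "regular_module S" by (rule LS)
  let ?D = "quotient_module (regular_module S) N"
  interpret Q: left_module S ?D by (rule L.quotient_left_module[OF N])
  interpret coinduction S F ?D
    using restrict_scalars[OF Q.left_module_axioms sub] sub \<open>ring S\<close>
    by (intro coinduction.intro coinduction_axioms.intro) auto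
  note LE = coinduced_left_module
  interpret E: left_module S E by (rule LE)
  note n = L.submoduleD[OF N, simplified]
  note q = L.add_quotient[OF N, simplified] L.smult_quotient[OF N, simplified]
    L.zero_quotient[OF N, simplified] L.carrier_quotient[OF N, simplified]
  \<comment> \<open>\<open>e\<close> is the image of the class of \<open>1\<close> under the
    embedding of \<open>S/N\<close>. Its multiple \<open>s e\<close> takes \<open>t\<close> to the
    class of \<open>t s\<close>; evaluating at \<open>1\<close> shows that it vanishes only for
    \<open>s\<close> in \<open>N\<close>.\<close>
  define e where "e = (\<lambda>t\<in>carrier S. N +>\<^bsub>regular_module S\<^esub> t)"
  have e: "e \<in> carrier E"
    unfolding e_def by (rule coinducedI) (auto simp: q F_carrier)
  have ann: "s \<odot>\<^bsub>E\<^esub> e = \<zero>\<^bsub>E\<^esub> \<longleftrightarrow> s \<in> N" if s: "s \<in> carrier S" for s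
  proof -
    have zero: "N +>\<^bsub>regular_module S\<^esub> y = \<zero>\<^bsub>?D\<^esub> \<longleftrightarrow> y \<in> N" if "y \<in> carrier S" for y
      using that L.coset_eq_iff[OF N, of y "\<zero>\<^bsub>S\<^esub>"] by (simp add: q S.minus_eq)
    have "s \<odot>\<^bsub>E\<^esub> e = \<zero>\<^bsub>E\<^esub> \<longleftrightarrow> (\<forall>t\<in>carrier S. t \<otimes>\<^bsub>S\<^esub> s \<in> N)"
      using s zero by (auto simp: coinduced_simps e_def fun_eq_iff restrict_def)
    also have "\<dots> \<longleftrightarrow> s \<in> N"
      using s n(5)[of _ s] by (metis S.l_one S.one_closed)
    finally show ?thesis .
  qed
  have hom: "(\<lambda>s. s \<odot>\<^bsub>E\<^esub> e) \<in> left_module_hom S (regular_module S) E"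
    using e by (intro left_module_homI) (auto simp: E.smult_closed E.smult_l_distr E.smult_assoc1)
  \<comment> \<open>A left ideal above \<open>N\<close> can be read off from the corresponding
    multiples of \<open>e\<close>; this carries chains back to \<open>S\<close> at the end.\<close>
  have inj: "s \<in> J"
    if "s \<odot>\<^bsub>E\<^esub> e = s' \<odot>\<^bsub>E\<^esub> e" "s \<in> carrier S" "s' \<in> J" "N \<subseteq> J" "submodule J S (regular_module S)" for s s' J
  proof -
    note j = L.submoduleD[OF that(5), simplified]
    have s': "s' \<in> carrier S" using j(2) that(3) by blast
    have "(s \<ominus>\<^bsub>S\<^esub> s') \<odot>\<^bsub>E\<^esub> e \<oplus>\<^bsub>E\<^esub> s' \<odot>\<^bsub>E\<^esub> e = s \<odot>\<^bsub>E\<^esub> e"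
      using E.smult_l_distr[of "s \<ominus>\<^bsub>S\<^esub> s'" s' e] that(2) s' e
      by (simp add: S.minus_eq S.add.m_assoc S.l_neg)
    then have "(s \<ominus>\<^bsub>S\<^esub> s') \<odot>\<^bsub>E\<^esub> e = \<zero>\<^bsub>E\<^esub>"
      using that(1,2) s' e by (simp add: E.smult_closed E.M.add.r_cancel_one')
    then have "s \<ominus>\<^bsub>S\<^esub> s' \<in> N" using ann that(2) s' by simp
    then have "(s \<ominus>\<^bsub>S\<^esub> s') \<oplus>\<^bsub>S\<^esub> s' \<in> J" using j(4) that(3,4) by blast
    then show ?thesis using that(2) s' by (simp add: S.minus_eq S.add.m_assoc S.l_neg)
  qed
  let ?X = "E.cyclic e" and ?v = "w \<odot>\<^bsub>E\<^esub> e"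
  have X: "submodule ?X S E" by (rule E.submodule_cyclic[OF e])
  have v: "?v \<in> ?X" "?v \<noteq> \<zero>\<^bsub>E\<^esub>" using w ann by (auto intro: E.cyclicI)
  have monoX: "?v \<in> U" if U: "submodule U S E" "U \<subseteq> ?X" "U \<noteq> {\<zero>\<^bsub>E\<^esub>}" for U
  proof -
    let ?J = "{s \<in> carrier (regular_module S). s \<odot>\<^bsub>E\<^esub> e \<in> U}"
    have "submodule ?J S (regular_module S)" by (rule submodule_vimage[OF LS LE hom U(1)])
    moreover have "N \<subseteq> ?J"
    proof
      fix s assume "s \<in> N"
      then have "s \<in> carrier S" "s \<odot>\<^bsub>E\<^esub> e = \<zero>\<^bsub>E\<^esub>" using n(2) ann[of s] by auto
      then show "s \<in> ?J" using E.submoduleD(3)[OF U(1)] by simp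
    qed
    moreover obtain u where "u \<in> U" "u \<noteq> \<zero>\<^bsub>E\<^esub>" using U(3) E.submoduleD(3)[OF U(1)] by blast
    then obtain s where "s \<in> carrier S" "s \<odot>\<^bsub>E\<^esub> e \<in> U" "s \<odot>\<^bsub>E\<^esub> e \<noteq> \<zero>\<^bsub>E\<^esub>"
      using U(2) by (blast elim: E.cyclicE)
    then have "s \<in> ?J" "s \<notin> N" using ann by auto
    ultimately have "w \<in> ?J" using mono[of ?J] by blast
    then show ?thesis by simp
  qed
  \<comment> \<open>The coinduced module is injective relative to itself, so it has a summand
    \<open>G\<close> above the copy of \<open>S/N\<close> in which \<open>?v\<close> still lies in
    every nonzero submodule; \<open>h\<close> retracts onto \<open>G\<close>.\<close>
  obtain G h where G: "submodule G S E" "?X \<subseteq> G"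
    "\<And>U. \<lbrakk> submodule U S E; U \<subseteq> G; U \<noteq> {\<zero>\<^bsub>E\<^esub>} \<rbrakk> \<Longrightarrow> ?v \<in> U"
    and h: "h \<in> left_module_hom S E (E\<lparr>carrier := G\<rparr>)" "\<And>y. y \<in> G \<Longrightarrow> h y = y"
    using E.monolithic_summand[OF coinduced_hom_extension[OF skew LE] X v(1) monoX] by blast
  let ?G = "E\<lparr>carrier := G\<rparr>"
  have LG: "left_module S ?G" by (rule E.submodule_left_module[OF G(1)])
  interpret G: left_module S ?G by (rule LG)
  note subG = E.submodule_restrict_iff[OF G(1)]
  have injective: "injective_module S ?G"
    unfolding injective_module_def
  proof (intro conjI allI impI LG)
    fix B :: "('a, 'a + ('a \<Rightarrow> 'a set)) module" and A f
    assume *: "left_module S B \<and> submodule A S B \<and> f \<in> left_module_hom S (B\<lparr>carrier := A\<rparr>) ?G"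
    have f: "f \<in> left_module_hom S (B\<lparr>carrier := A\<rparr>) E" and fG: "\<And>x. x \<in> A \<Longrightarrow> f x \<in> G"
      using * E.submoduleD(1)[OF G(1)] by (auto simp: left_module_hom_def)
    \<comment> \<open>Extend into the large module first; composing with the retraction
      \<open>h\<close> brings the values into \<open>G\<close> and leaves those on \<open>A\<close>
      unchanged.\<close>
    obtain g where g: "g \<in> left_module_hom S B E" "\<And>x. x \<in> A \<Longrightarrow> g x = f x"
      using coinduced_hom_extension[OF skew _ _ f] * by blast
    show "\<exists>g\<in>left_module_hom S B ?G. \<forall>x\<in>A. g x = f x"
      using left_module_hom_comp[OF g(1) h(1)] g(2) h(2) fG by (intro bexI[of _ "h \<circ> g"]) auto
  qed
  \<comment> \<open>As \<open>?v\<close> lies in every nonzero submodule of \<open>G\<close>, the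
    submodule that it generates is the smallest of them: it is simple, and essential in
    \<open>G\<close>.\<close>
  let ?V = "E.cyclic ?v"
  have vE: "?v \<in> carrier E" using w e by (simp add: E.smult_closed)
  have V: "submodule ?V S E" "?V \<subseteq> G"
    using E.submodule_cyclic[OF vE] E.cyclic_subset[OF G(1)] v(1) G(2) by blast+
  have vV: "?v \<in> ?V" using E.cyclic_self[OF vE] .
  have hull: "injective_hull S ?V ?G"
    unfolding injective_hull_def essential_submodule_def
  proof (intro conjI allI impI injective)
    show "submodule ?V S ?G" using V subG by simp
    fix U assume "submodule U S ?G \<and> U \<noteq> {\<zero>\<^bsub>?G\<^esub>}"
    then have "?v \<in> U" using G(3) subG by simp
    then show "U \<inter> ?V \<noteq> {\<zero>\<^bsub>?G\<^esub>}" using vV v(2) by auto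
  qed
  have simple: "simple_module S (?G\<lparr>carrier := ?V\<rparr>)"
    unfolding simple_module_def
  proof (intro conjI allI impI)
    show "left_module S (?G\<lparr>carrier := ?V\<rparr>)" using E.submodule_left_module[OF V(1)] by simp
    show "carrier (?G\<lparr>carrier := ?V\<rparr>) \<noteq> {\<zero>\<^bsub>?G\<lparr>carrier := ?V\<rparr>\<^esub>}" using vV v(2) by auto
    fix U assume "submodule U S (?G\<lparr>carrier := ?V\<rparr>)"
    then have U: "submodule U S E" "U \<subseteq> ?V" using E.submodule_restrict_iff[OF V(1)] by auto
    show "U = {\<zero>\<^bsub>?G\<lparr>carrier := ?V\<rparr>\<^esub>} \<or> U = carrier (?G\<lparr>carrier := ?V\<rparr>)"
      using G(3)[OF U(1)] U V(2) E.cyclic_subset[OF U(1)] by auto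
  qed
  have eG: "e \<in> G" using G(2) E.cyclic_self[OF e] by blast
  have "locally_artinian_module S ?G" using \<open>diamond S\<close> hull simple unfolding diamond_def by blast
  then have "artinian_module S (?G\<lparr>carrier := submodule_generated S ?G {e}\<rparr>)"
    unfolding locally_artinian_module_def using eG by simp
  moreover have "submodule_generated S ?G {e} = ?X"
    using G.submodule_generated_singleton[of e] eG by (simp add: G.cyclic_def E.cyclic_def)
  ultimately have art: "artinian_module S (E\<lparr>carrier := ?X\<rparr>)" by simp
  show ?thesis
  proof (rule dcc_betweenI)
    fix J :: "nat \<Rightarrow> 'a set"
    assume J: "\<And>i. submodule (J i) S (regular_module S)" "\<And>i. N \<subseteq> J i" "\<And>i. J (Suc i) \<subseteq> J i"
    have JS: "\<And>i. J i \<subseteq> carrier S" using L.submoduleD(1)[OF J(1)] by simp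
    let ?I = "\<lambda>i. (\<lambda>s. s \<odot>\<^bsub>E\<^esub> e) ` J i"
    have I: "submodule (?I i) S (E\<lparr>carrier := ?X\<rparr>)" for i
      using submodule_image[OF LS LE hom J(1)] E.submodule_restrict_iff[OF X] JS[of i]
      by (auto intro: E.cyclicI)
    obtain k where k: "\<forall>i\<ge>k. ?I i = ?I k"
      using artinian_moduleD[OF art, of ?I, OF I image_mono[OF J(3)]] ..
    have "J i = J k" if i: "i \<ge> k" for i
    proof
      show "J i \<subseteq> J k" using i J(3) by (rule lift_Suc_antimono_le[rotated])
      show "J k \<subseteq> J i"
      proof
        fix s assume s: "s \<in> J k"
        then obtain s' where "s' \<in> J i" "s \<odot>\<^bsub>E\<^esub> e = s' \<odot>\<^bsub>E\<^esub> e" using k i by blast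
        then show "s \<in> J i" using inj[OF _ _ _ J(2) J(1)] s JS by blast
      qed
    qed
    then show "\<exists>k. \<forall>i\<ge>k. J i = J k" by blast
  qed
qed

text \<open>The left ideals \<open>N\<close> above \<open>L\<close> with \<open>S/N\<close> Artinian
  are closed under finite intersections. As \<open>A/L\<close> is Artinian, one of them has a
  minimal \<open>N \<inter> A\<close>. A point of \<open>N \<inter> A\<close> outside
  \<open>L\<close> could be separated from \<open>L\<close> by a further such left ideal, against
  minimality. So \<open>N \<inter> A\<close> is contained in \<open>L\<close>, and essentiality
  gives \<open>N = L\<close>.\<close>

lemma diamond_essential_dcc:
  assumes "ring S" and sub: "subring F S" and skew: "skew_field (S\<lparr>carrier := F\<rparr>)" and "diamond S"
    and L: "submodule L S (regular_module S)" and A: "submodule A S (regular_module S)" and "L \<subseteq> A"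
    and dcc: "dcc_between S (regular_module S) L A"
    and essential: "\<And>J. \<lbrakk> submodule J S (regular_module S); L \<subseteq> J; J \<inter> A \<subseteq> L \<rbrakk> \<Longrightarrow> J = L"
  shows "dcc_between S (regular_module S) L (carrier S)"
proof -
  interpret M: left_module S "regular_module S" by (rule regular_left_module[OF \<open>ring S\<close>])
  let ?C = "\<lambda>N. submodule N S (regular_module S) \<and> L \<subseteq> N \<and> dcc_between S (regular_module S) N (carrier S)"
  have "?C (carrier S)"
    using M.carrier_submodule M.submoduleD(1)[OF L] by (simp add: dcc_between_refl)
  then obtain J where J: "J \<in> {N \<inter> A | N. ?C N}" and
    min: "\<And>I. I \<in> {N \<inter> A | N. ?C N} \<Longrightarrow> I \<subseteq> J \<Longrightarrow> I = J"
    using dcc_between_minimal[OF dcc, of "{N \<inter> A | N. ?C N}"] M.submodule_Int[OF _ A] \<open>L \<subseteq> A\<close>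
    by (smt (verit, best) Collect_empty_eq Int_subset_iff inf_le2 mem_Collect_eq)
  then obtain N where N: "?C N" "J = N \<inter> A" by blast
  have "N \<inter> A \<subseteq> L"
  proof (rule ccontr)
    assume "\<not> N \<inter> A \<subseteq> L"
    then obtain w where w: "w \<in> N" "w \<in> A" "w \<notin> L" by blast
    then have "L \<inter> {w} = {}" by simp
    \<comment> \<open>Maximality of \<open>N'\<close> among the left ideals without \<open>w\<close>
      puts \<open>w\<close> into every left ideal strictly above it, so \<open>S/N'\<close> has a
      smallest nonzero submodule.\<close>
    then obtain N' where N': "submodule N' S (regular_module S)" "N' \<inter> {w} = {}" "L \<subseteq> N'"
      and max: "\<And>P. \<lbrakk> submodule P S (regular_module S); P \<inter> {w} = {}; N' \<subseteq> P \<rbrakk> \<Longrightarrow> P = N'"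
      using M.maximal_submodule_avoiding[OF L] by blast
    have "dcc_between S (regular_module S) N' (carrier S)"
      using \<open>ring S\<close> sub skew \<open>diamond S\<close> N'(1)
    proof (rule diamond_monolithic_dcc)
      show "w \<in> carrier S" "w \<notin> N'" using w M.submoduleD(1)[OF A] N' by auto
      show "w \<in> P" if "submodule P S (regular_module S)" "N' \<subseteq> P" "P \<noteq> N'" for P
        using max that by blast
    qed
    then have "?C (N \<inter> N')"
      using M.dcc_between_Int[OF _ N'(1), of N] M.submodule_Int[OF _ N'(1), of N] N(1) N'(3) by simp
    then have "N \<inter> N' \<inter> A = J" by (intro min) (use N(2) in auto)
    then show False using w N(2) N'(2) by blast
  qed
  then show ?thesis using essential N(1) by blast
qed

section \<open>Derivations\<close>

locale derivation_ring = ring R for R (structure) and d +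
  assumes deriv: "derivation R d"
begin

lemma d_closed [simp, intro]: "a \<in> carrier R \<Longrightarrow> d a \<in> carrier R"
  using deriv by (auto simp: derivation_def)

lemma d_add: "a \<in> carrier R \<Longrightarrow> b \<in> carrier R \<Longrightarrow> d (a \<oplus> b) = d a \<oplus> d b"
  using deriv by (simp add: derivation_def)

lemma d_mult: "a \<in> carrier R \<Longrightarrow> b \<in> carrier R \<Longrightarrow> d (a \<otimes> b) = d a \<otimes> b \<oplus> a \<otimes> d b"
  using deriv by (simp add: derivation_def)

lemma d_zero [simp]: "d \<zero> = \<zero>"
  using d_add[of \<zero> \<zero>] d_closed[of \<zero>] by (metis add.r_cancel_one' l_zero zero_closed)

lemma d_one [simp]: "d \<one> = \<zero>"
  using d_mult[of \<one> \<one>] d_closed[of \<one>] by (metis add.r_cancel_one' l_one one_closed r_one)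

lemma d_minus: "a \<in> carrier R \<Longrightarrow> d (\<ominus> a) = \<ominus> d a"
  using d_add[of "\<ominus> a" a] by (metis a_inv_closed d_closed d_zero l_neg minus_equality)

lemma funpow_d_closed [simp, intro]: "a \<in> carrier R \<Longrightarrow> (d ^^ n) a \<in> carrier R"
  by (induction n) auto

lemma funpow_d_zero [simp]: "(d ^^ n) \<zero> = \<zero>"
  by (induction n) auto

lemma funpow_d_add:
  "a \<in> carrier R \<Longrightarrow> b \<in> carrier R \<Longrightarrow> (d ^^ n) (a \<oplus> b) = (d ^^ n) a \<oplus> (d ^^ n) b"
  by (induction n) (auto simp: d_add)

lemma funpow_d_eq_zero_mono: "(d ^^ m) a = \<zero> \<Longrightarrow> m \<le> n \<Longrightarrow> (d ^^ n) a = \<zero>"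
  by (metis comp_apply funpow_add funpow_d_zero le_add_diff_inverse2)

text \<open>Leibniz's rule: of the products of a derivative of \<open>a\<close> with one of
  \<open>b\<close>, of total order \<open>m + n\<close>, only the one of orders \<open>m\<close> and
  \<open>n\<close> survives. \<open>N\<close> is the binomial coefficient \<open>m + n\<close> over
  \<open>m\<close>; the induction, which is Pascal's recursion, records only that it is
  positive.\<close>

lemma funpow_d_mult:
  assumes "a \<in> carrier R" "b \<in> carrier R" "(d ^^ Suc m) a = \<zero>" "(d ^^ Suc n) b = \<zero>"
  shows "\<exists>N::nat. N > 0 \<and> (d ^^ (m + n)) (a \<otimes> b) = [N] \<cdot>\<^bsub>R\<^esub> ((d ^^ m) a \<otimes> (d ^^ n) b)"
  using assms
proof (induction "m + n" arbitrary: m n a b)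
  case 0
  then show ?case by (intro exI[of _ 1]) (simp add: add_pow_def)
next
  case (Suc k)
  let ?y = "(d ^^ m) a \<otimes> (d ^^ n) b"
  have y: "?y \<in> carrier R" using Suc.prems by auto
  \<comment> \<open>For \<open>m = 0\<close> this summand vanishes because \<open>d a = 0\<close>,
    so \<open>N\<close> may be \<open>0\<close>; the same holds for the other summand if
    \<open>n = 0\<close>. As \<open>m + n\<close> is positive, at least one of the two coefficients
    is.\<close>
  have "\<exists>N::nat. (m > 0 \<longrightarrow> N > 0) \<and> (d ^^ k) (d a \<otimes> b) = [N] \<cdot>\<^bsub>R\<^esub> ?y"
  proof (cases m)
    case 0
    then show ?thesis using Suc.prems by (intro exI[of _ 0]) auto
  next
    case (Suc m')
    then show ?thesis
      using Suc.hyps(1)[of m' n "d a" b] Suc.hyps(2) Suc.prems by (auto simp: funpow_swap1)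
  qed
  moreover have "\<exists>N::nat. (n > 0 \<longrightarrow> N > 0) \<and> (d ^^ k) (a \<otimes> d b) = [N] \<cdot>\<^bsub>R\<^esub> ?y"
  proof (cases n)
    case 0
    then show ?thesis using Suc.prems by (intro exI[of _ 0]) auto
  next
    case (Suc n')
    then show ?thesis
      using Suc.hyps(1)[of m n' a "d b"] Suc.hyps(2) Suc.prems by (auto simp: funpow_swap1)
  qed
  ultimately obtain N N' :: nat where N: "m > 0 \<longrightarrow> N > 0" "n > 0 \<longrightarrow> N' > 0"
    "(d ^^ k) (d a \<otimes> b) = [N] \<cdot>\<^bsub>R\<^esub> ?y" "(d ^^ k) (a \<otimes> d b) = [N'] \<cdot>\<^bsub>R\<^esub> ?y" by blast
  have "(d ^^ (m + n)) (a \<otimes> b) = (d ^^ k) (d a \<otimes> b \<oplus> a \<otimes> d b)"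
    using Suc.prems(1,2) by (simp add: Suc.hyps(2)[symmetric] funpow_swap1 d_mult)
  also have "\<dots> = [N] \<cdot>\<^bsub>R\<^esub> ?y \<oplus> [N'] \<cdot>\<^bsub>R\<^esub> ?y"
    using Suc.prems(1,2) by (simp add: funpow_d_add N)
  also have "\<dots> = [(N + N')] \<cdot>\<^bsub>R\<^esub> ?y" using y by (simp add: add.nat_pow_mult)
  finally have "(d ^^ (m + n)) (a \<otimes> b) = [(N + N')] \<cdot>\<^bsub>R\<^esub> ?y" .
  moreover have "N + N' > 0" using N Suc.hyps(2) by auto
  ultimately show ?case by blast
qed

text \<open>The number \<open>n\<close> serves as the degree of \<open>a\<close>; for polynomials
  over a field of characteristic 0 with the usual derivative it is the ordinary degree.\<close>

lemma last_nonzero_derivative: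
  assumes "locally_nilpotent R d" "a \<in> carrier R" "a \<noteq> \<zero>"
  obtains n where "(d ^^ n) a \<noteq> \<zero>" "(d ^^ Suc n) a = \<zero>"
proof -
  let ?P = "\<lambda>n. (d ^^ n) a = \<zero>"
  have ex: "\<exists>n. ?P n" using assms by (auto simp: locally_nilpotent_def)
  have L: "?P (LEAST n. ?P n)" using LeastI_ex[OF ex] .
  then obtain n where n: "(LEAST n. ?P n) = Suc n" using assms(3) by (cases "LEAST n. ?P n") auto
  have "\<not> ?P n" using not_less_Least[of n ?P] n by simp
  then show thesis using L n that by simp
qed

text \<open>Compare degrees with respect to \<open>d\<close>: the degree of \<open>b a\<close> is the sum of those of \<open>b\<close> and \<open>a\<close>,
  hence exceeds that of \<open>c + d b\<close>.\<close>

lemma twisted_eigenvector_trivial: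
  assumes "nc_domain R" and nil: "locally_nilpotent R d"
    and torsion_free: "\<And>(N::nat) y. \<lbrakk> N > 0; y \<in> carrier R; [N] \<cdot>\<^bsub>R\<^esub> y = \<zero> \<rbrakk> \<Longrightarrow> y = \<zero>"
    and a: "a \<in> carrier R" "d a \<noteq> \<zero>" and b: "b \<in> carrier R"
    and c: "c \<in> carrier R" "d c = \<zero>" and eq: "b \<otimes> a = c \<oplus> d b"
  shows "c = \<zero>"
proof (cases "b = \<zero>")
  case True
  then show ?thesis using eq a c by simp
next
  case False
  interpret nc_domain R by fact
  obtain m where m: "(d ^^ m) b \<noteq> \<zero>" "(d ^^ Suc m) b = \<zero>"
    using last_nonzero_derivative[OF nil b False] by blast
  have "a \<noteq> \<zero>" using a by auto
  then obtain n where n: "(d ^^ n) a \<noteq> \<zero>" "(d ^^ Suc n) a = \<zero>"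
    using last_nonzero_derivative[OF nil a(1)] by blast
  \<comment> \<open>Since \<open>d a\<close> is nonzero, \<open>a\<close> has positive degree. So
    \<open>m + n\<close> is at least 1, and the power \<open>m + n\<close> of \<open>d\<close> kills
    the constant \<open>c\<close>; it kills \<open>d b\<close> because the power
    \<open>m + 1\<close> kills \<open>b\<close>.\<close>
  have "n > 0" using n a by (cases n) auto
  obtain N :: nat where N: "N > 0" "(d ^^ (m + n)) (b \<otimes> a) = [N] \<cdot>\<^bsub>R\<^esub> ((d ^^ m) b \<otimes> (d ^^ n) a)"
    using funpow_d_mult[OF b a(1) m(2) n(2)] by blast
  have "(d ^^ (m + n)) c = \<zero>"
    using funpow_d_eq_zero_mono[of 1 c "m + n"] c \<open>n > 0\<close> by simp
  moreover have "(d ^^ (m + n)) (d b) = \<zero>"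
    using funpow_d_eq_zero_mono[OF m(2), of "Suc (m + n)"] by (simp add: funpow_swap1)
  ultimately have "(d ^^ (m + n)) (b \<otimes> a) = \<zero>"
    unfolding eq using b c by (simp add: funpow_d_add)
  then have "(d ^^ m) b \<otimes> (d ^^ n) a = \<zero>"
    using torsion_free[OF N(1), of "(d ^^ m) b \<otimes> (d ^^ n) a"] N(2) a b by simp
  then show ?thesis using no_zero_divisors a b m(1) n(1) funpow_d_closed by blast
qed

end

section \<open>Differential operator rings\<close>

locale differential_operator_ring = derivation_ring R d + S: ring S
  for R :: "('r, 'c) ring_scheme" (structure) and d and S :: "('s, 'e) ring_scheme" and \<iota> \<theta> +
  assumes diff_op: "diff_op_ring R d S \<iota> \<theta>"
begin

lemma theta [simp, intro]: "\<theta> \<in> carrier S"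
  using diff_op by (simp add: diff_op_ring_def)

lemma iota_hom: "\<iota> \<in> ring_hom R S"
  using diff_op by (simp add: diff_op_ring_def)

sublocale hom: ring_hom_ring R S \<iota>
  by (rule ring_hom_ringI2[OF ring_axioms S.ring_axioms iota_hom])

lemma theta_iota:
  "a \<in> carrier R \<Longrightarrow> \<theta> \<otimes>\<^bsub>S\<^esub> \<iota> a = \<iota> a \<otimes>\<^bsub>S\<^esub> \<theta> \<oplus>\<^bsub>S\<^esub> \<iota> (d a)"
  using diff_op by (simp add: diff_op_ring_def)

text \<open>The operators of degree less than \<open>n\<close>. Building them as a filtration
  permits induction on the top term; uniqueness of coefficients enters only in the proof that a
  nonzero top term is not in the stage below it.\<close>

primrec below :: "nat \<Rightarrow> 's set" where
  "below 0 = {\<zero>\<^bsub>S\<^esub>}"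
| "below (Suc n) = {f \<oplus>\<^bsub>S\<^esub> \<iota> c \<otimes>\<^bsub>S\<^esub> \<theta> [^]\<^bsub>S\<^esub> n | f c. f \<in> below n \<and> c \<in> carrier R}"

lemma below_closed: "f \<in> below n \<Longrightarrow> f \<in> carrier S"
  by (induction n arbitrary: f) auto

lemma below_SucI: "f \<in> below n \<Longrightarrow> c \<in> carrier R \<Longrightarrow> f \<oplus>\<^bsub>S\<^esub> \<iota> c \<otimes>\<^bsub>S\<^esub> \<theta> [^]\<^bsub>S\<^esub> n \<in> below (Suc n)"
  by auto

lemma below_SucE:
  assumes "f \<in> below (Suc n)"
  obtains g c where "g \<in> below n" "c \<in> carrier R" "f = g \<oplus>\<^bsub>S\<^esub> \<iota> c \<otimes>\<^bsub>S\<^esub> \<theta> [^]\<^bsub>S\<^esub> n"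
  using assms by auto

declare below.simps(2) [simp del]

lemma below_Suc: "f \<in> below n \<Longrightarrow> f \<in> below (Suc n)"
  using below_SucI[of f n \<zero>] below_closed[of f n] by simp

lemma below_mono: "f \<in> below m \<Longrightarrow> m \<le> n \<Longrightarrow> f \<in> below n"
  by (rule subsetD[OF lift_Suc_mono_le[of below]]) (use below_Suc in auto)

lemma below_zero [simp]: "\<zero>\<^bsub>S\<^esub> \<in> below n"
  by (induction n) (auto intro: below_Suc)

lemma below_monomial: "c \<in> carrier R \<Longrightarrow> \<iota> c \<otimes>\<^bsub>S\<^esub> \<theta> [^]\<^bsub>S\<^esub> n \<in> below (Suc n)"
  using below_SucI[of "\<zero>\<^bsub>S\<^esub>" n c] by simp

lemma below_add: "f \<in> below n \<Longrightarrow> g \<in> below n \<Longrightarrow> f \<oplus>\<^bsub>S\<^esub> g \<in> below n"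
proof (induction n arbitrary: f g)
  case (Suc n)
  obtain f' c where f: "f' \<in> below n" "c \<in> carrier R" "f = f' \<oplus>\<^bsub>S\<^esub> \<iota> c \<otimes>\<^bsub>S\<^esub> \<theta> [^]\<^bsub>S\<^esub> n"
    using Suc.prems(1) by (rule below_SucE)
  obtain g' e where g: "g' \<in> below n" "e \<in> carrier R" "g = g' \<oplus>\<^bsub>S\<^esub> \<iota> e \<otimes>\<^bsub>S\<^esub> \<theta> [^]\<^bsub>S\<^esub> n"
    using Suc.prems(2) by (rule below_SucE)
  have "f \<oplus>\<^bsub>S\<^esub> g = (f' \<oplus>\<^bsub>S\<^esub> g') \<oplus>\<^bsub>S\<^esub> \<iota> (c \<oplus> e) \<otimes>\<^bsub>S\<^esub> \<theta> [^]\<^bsub>S\<^esub> n"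
    using f g by (simp add: below_closed S.l_distr S.a_ac)
  then show ?case using below_SucI[OF Suc.IH[OF f(1) g(1)], of "c \<oplus> e"] f(2) g(2) by simp
qed simp

lemma below_iota_mult: "f \<in> below n \<Longrightarrow> b \<in> carrier R \<Longrightarrow> \<iota> b \<otimes>\<^bsub>S\<^esub> f \<in> below n"
proof (induction n arbitrary: f)
  case (Suc n)
  obtain f' c where f: "f' \<in> below n" "c \<in> carrier R" "f = f' \<oplus>\<^bsub>S\<^esub> \<iota> c \<otimes>\<^bsub>S\<^esub> \<theta> [^]\<^bsub>S\<^esub> n"
    using Suc.prems(1) by (rule below_SucE)
  have "\<iota> b \<otimes>\<^bsub>S\<^esub> f = \<iota> b \<otimes>\<^bsub>S\<^esub> f' \<oplus>\<^bsub>S\<^esub> \<iota> (b \<otimes> c) \<otimes>\<^bsub>S\<^esub> \<theta> [^]\<^bsub>S\<^esub> n"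
    using f Suc.prems(2) by (simp add: below_closed S.r_distr S.m_assoc)
  then show ?case using below_SucI[OF Suc.IH[OF f(1)], of "b \<otimes> c"] f(2) Suc.prems(2) by simp
qed simp

lemma below_minus: "f \<in> below n \<Longrightarrow> \<ominus>\<^bsub>S\<^esub> f \<in> below n"
  using below_iota_mult[of f n "\<ominus> \<one>"] below_closed[of f n] by (simp add: S.l_minus)

lemma below_mult_theta: "f \<in> below n \<Longrightarrow> f \<otimes>\<^bsub>S\<^esub> \<theta> \<in> below (Suc n)"
proof (induction n arbitrary: f)
  case 0
  then show ?case by simp
next
  case (Suc n)
  obtain f' c where f: "f' \<in> below n" "c \<in> carrier R" "f = f' \<oplus>\<^bsub>S\<^esub> \<iota> c \<otimes>\<^bsub>S\<^esub> \<theta> [^]\<^bsub>S\<^esub> n"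
    using Suc.prems(1) by (rule below_SucE)
  have "f \<otimes>\<^bsub>S\<^esub> \<theta> = f' \<otimes>\<^bsub>S\<^esub> \<theta> \<oplus>\<^bsub>S\<^esub> \<iota> c \<otimes>\<^bsub>S\<^esub> \<theta> [^]\<^bsub>S\<^esub> Suc n"
    using f by (simp add: below_closed S.l_distr S.m_assoc)
  then show ?case using below_SucI[OF Suc.IH[OF f(1)] f(2)] by simp
qed

text \<open>Moving a coefficient across a power of \<open>\<theta>\<close> changes only terms of
  lower degree. The induction has to vary \<open>a\<close>, since the \<open>\<theta>\<close> next
  to \<open>a\<close> also produces \<open>d a\<close>.\<close>

lemma theta_pow_iota:
  "a \<in> carrier R \<Longrightarrow> \<exists>g\<in>below n. \<theta> [^]\<^bsub>S\<^esub> n \<otimes>\<^bsub>S\<^esub> \<iota> a = g \<oplus>\<^bsub>S\<^esub> \<iota> a \<otimes>\<^bsub>S\<^esub> \<theta> [^]\<^bsub>S\<^esub> n"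
proof (induction n arbitrary: a)
  case 0
  then show ?case by simp
next
  case (Suc n)
  obtain g where g: "g \<in> below n" "\<theta> [^]\<^bsub>S\<^esub> n \<otimes>\<^bsub>S\<^esub> \<iota> a = g \<oplus>\<^bsub>S\<^esub> \<iota> a \<otimes>\<^bsub>S\<^esub> \<theta> [^]\<^bsub>S\<^esub> n"
    using Suc.IH[OF Suc.prems] by blast
  obtain h where h: "h \<in> below n"
    "\<theta> [^]\<^bsub>S\<^esub> n \<otimes>\<^bsub>S\<^esub> \<iota> (d a) = h \<oplus>\<^bsub>S\<^esub> \<iota> (d a) \<otimes>\<^bsub>S\<^esub> \<theta> [^]\<^bsub>S\<^esub> n"
    using Suc.IH[of "d a"] Suc.prems by blast
  have "\<theta> [^]\<^bsub>S\<^esub> Suc n \<otimes>\<^bsub>S\<^esub> \<iota> a =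
      (\<theta> [^]\<^bsub>S\<^esub> n \<otimes>\<^bsub>S\<^esub> \<iota> a) \<otimes>\<^bsub>S\<^esub> \<theta> \<oplus>\<^bsub>S\<^esub> \<theta> [^]\<^bsub>S\<^esub> n \<otimes>\<^bsub>S\<^esub> \<iota> (d a)"
    using Suc.prems by (simp add: S.m_assoc theta_iota S.r_distr)
  also have "\<dots> = (g \<otimes>\<^bsub>S\<^esub> \<theta> \<oplus>\<^bsub>S\<^esub> (h \<oplus>\<^bsub>S\<^esub> \<iota> (d a) \<otimes>\<^bsub>S\<^esub> \<theta> [^]\<^bsub>S\<^esub> n)) \<oplus>\<^bsub>S\<^esub> \<iota> a \<otimes>\<^bsub>S\<^esub> \<theta> [^]\<^bsub>S\<^esub> Suc n"
    unfolding g(2) h(2) using Suc.prems g(1) h(1)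
    by (simp add: below_closed S.l_distr S.m_assoc S.a_ac)
  finally show ?case
    using below_add[OF below_mult_theta[OF g(1)] below_SucI[OF h(1), of "d a"]] Suc.prems
    by (intro bexI[of _ "g \<otimes>\<^bsub>S\<^esub> \<theta> \<oplus>\<^bsub>S\<^esub> (h \<oplus>\<^bsub>S\<^esub> \<iota> (d a) \<otimes>\<^bsub>S\<^esub> \<theta> [^]\<^bsub>S\<^esub> n)"]) simp_all
qed

lemma below_mult_iota: "f \<in> below n \<Longrightarrow> a \<in> carrier R \<Longrightarrow> f \<otimes>\<^bsub>S\<^esub> \<iota> a \<in> below n"
proof (induction n arbitrary: f)
  case (Suc n)
  obtain f' c where f: "f' \<in> below n" "c \<in> carrier R" "f = f' \<oplus>\<^bsub>S\<^esub> \<iota> c \<otimes>\<^bsub>S\<^esub> \<theta> [^]\<^bsub>S\<^esub> n"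
    using Suc.prems(1) by (rule below_SucE)
  obtain g where g: "g \<in> below n" "\<theta> [^]\<^bsub>S\<^esub> n \<otimes>\<^bsub>S\<^esub> \<iota> a = g \<oplus>\<^bsub>S\<^esub> \<iota> a \<otimes>\<^bsub>S\<^esub> \<theta> [^]\<^bsub>S\<^esub> n"
    using theta_pow_iota[OF Suc.prems(2)] by blast
  have "f \<otimes>\<^bsub>S\<^esub> \<iota> a = f' \<otimes>\<^bsub>S\<^esub> \<iota> a \<oplus>\<^bsub>S\<^esub> \<iota> c \<otimes>\<^bsub>S\<^esub> (\<theta> [^]\<^bsub>S\<^esub> n \<otimes>\<^bsub>S\<^esub> \<iota> a)"
    using f Suc.prems(2) by (simp add: below_closed S.l_distr S.m_assoc)
  also have "\<dots> = (f' \<otimes>\<^bsub>S\<^esub> \<iota> a \<oplus>\<^bsub>S\<^esub> \<iota> c \<otimes>\<^bsub>S\<^esub> g) \<oplus>\<^bsub>S\<^esub> \<iota> (c \<otimes> a) \<otimes>\<^bsub>S\<^esub> \<theta> [^]\<^bsub>S\<^esub> n"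
    unfolding g(2) using f(1,2) g(1) Suc.prems(2)
    by (simp add: below_closed S.r_distr S.m_assoc S.a_assoc)
  finally show ?case
    using below_SucI[OF below_add[OF Suc.IH[OF f(1) Suc.prems(2)] below_iota_mult[OF g(1) f(2)]], of "c \<otimes> a"]
      f(2) Suc.prems(2) by simp
qed simp

section \<open>Coefficients with respect to the powers of \<open>\<theta>\<close>\<close>

lemma below_sum:
  assumes "\<And>i. i < n \<Longrightarrow> c i \<in> carrier R"
  shows "(\<Oplus>\<^bsub>S\<^esub>i\<in>{..<n}. \<iota> (c i) \<otimes>\<^bsub>S\<^esub> \<theta> [^]\<^bsub>S\<^esub> i) \<in> below n"
  using assms
proof (induction n)
  case (Suc n)
  have "(\<Oplus>\<^bsub>S\<^esub>i\<in>{..<Suc n}. \<iota> (c i) \<otimes>\<^bsub>S\<^esub> \<theta> [^]\<^bsub>S\<^esub> i) =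
      \<iota> (c n) \<otimes>\<^bsub>S\<^esub> \<theta> [^]\<^bsub>S\<^esub> n \<oplus>\<^bsub>S\<^esub> (\<Oplus>\<^bsub>S\<^esub>i\<in>{..<n}. \<iota> (c i) \<otimes>\<^bsub>S\<^esub> \<theta> [^]\<^bsub>S\<^esub> i)"
    unfolding lessThan_Suc using Suc.prems by (intro S.finsum_insert) auto
  also have "\<dots> = (\<Oplus>\<^bsub>S\<^esub>i\<in>{..<n}. \<iota> (c i) \<otimes>\<^bsub>S\<^esub> \<theta> [^]\<^bsub>S\<^esub> i) \<oplus>\<^bsub>S\<^esub> \<iota> (c n) \<otimes>\<^bsub>S\<^esub> \<theta> [^]\<^bsub>S\<^esub> n"
    using Suc.prems by (intro S.add.m_comm S.finsum_closed) auto
  finally show ?case using below_SucI[OF Suc.IH, of "c n"] Suc.prems by simp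
qed simp

text \<open>Expansions are unique as sums over the support, whereas induction runs over initial
  segments; the additional terms are zero.\<close>

lemma sum_support:
  fixes n :: nat
  assumes "range c \<subseteq> carrier R" "{i. c i \<noteq> \<zero>} \<subseteq> {..<n}"
  shows "(\<Oplus>\<^bsub>S\<^esub>i\<in>{i. c i \<noteq> \<zero>}. \<iota> (c i) \<otimes>\<^bsub>S\<^esub> \<theta> [^]\<^bsub>S\<^esub> i) =
    (\<Oplus>\<^bsub>S\<^esub>i\<in>{..<n}. \<iota> (c i) \<otimes>\<^bsub>S\<^esub> \<theta> [^]\<^bsub>S\<^esub> i)"
  using assms by (intro S.add.finprod_mono_neutral_cong_left) (auto simp: range_subsetD)

lemma unique_expansion:
  "s \<in> carrier S \<Longrightarrow> \<exists>!c :: nat \<Rightarrow> 'r. range c \<subseteq> carrier R \<and> finite {i. c i \<noteq> \<zero>} \<and>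
    s = (\<Oplus>\<^bsub>S\<^esub>i\<in>{i. c i \<noteq> \<zero>}. \<iota> (c i) \<otimes>\<^bsub>S\<^esub> \<theta> [^]\<^bsub>S\<^esub> i)"
  using diff_op by (simp add: diff_op_ring_def)

lemma below_cover: "s \<in> carrier S \<Longrightarrow> \<exists>n. s \<in> below n"
proof -
  assume "s \<in> carrier S"
  then obtain c :: "nat \<Rightarrow> 'r" where c: "range c \<subseteq> carrier R" "finite {i. c i \<noteq> \<zero>}"
    "s = (\<Oplus>\<^bsub>S\<^esub>i\<in>{i. c i \<noteq> \<zero>}. \<iota> (c i) \<otimes>\<^bsub>S\<^esub> \<theta> [^]\<^bsub>S\<^esub> i)"
    using ex1_implies_ex[OF unique_expansion] by blast
  obtain n where n: "{i. c i \<noteq> \<zero>} \<subseteq> {..<n}" using finite_nat_iff_bounded c(2) by blast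
  show ?thesis using below_sum[of n c] c sum_support[OF c(1) n] by auto
qed

lemma below_coefficients:
  assumes "f \<in> below n"
  obtains c where "range c \<subseteq> carrier R" "{i. c i \<noteq> \<zero>} \<subseteq> {..<n}"
    "f = (\<Oplus>\<^bsub>S\<^esub>i\<in>{i. c i \<noteq> \<zero>}. \<iota> (c i) \<otimes>\<^bsub>S\<^esub> \<theta> [^]\<^bsub>S\<^esub> i)"
proof -
  have "\<exists>c. range c \<subseteq> carrier R \<and> {i. c i \<noteq> \<zero>} \<subseteq> {..<n} \<and>
      f = (\<Oplus>\<^bsub>S\<^esub>i\<in>{..<n}. \<iota> (c i) \<otimes>\<^bsub>S\<^esub> \<theta> [^]\<^bsub>S\<^esub> i)"
    using assms
  proof (induction n arbitrary: f)
    case 0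
    then show ?case by (intro exI[of _ "\<lambda>_. \<zero>"]) auto
  next
    case (Suc n)
    obtain g e where g: "g \<in> below n" "e \<in> carrier R" "f = g \<oplus>\<^bsub>S\<^esub> \<iota> e \<otimes>\<^bsub>S\<^esub> \<theta> [^]\<^bsub>S\<^esub> n"
      using Suc.prems by (rule below_SucE)
    obtain c where c: "range c \<subseteq> carrier R" "{i. c i \<noteq> \<zero>} \<subseteq> {..<n}"
      "g = (\<Oplus>\<^bsub>S\<^esub>i\<in>{..<n}. \<iota> (c i) \<otimes>\<^bsub>S\<^esub> \<theta> [^]\<^bsub>S\<^esub> i)" using Suc.IH[OF g(1)] by blast
    let ?c = "c(n := e)"
    have cR: "c i \<in> carrier R" for i using c(1) by auto
    have "(\<Oplus>\<^bsub>S\<^esub>i\<in>{..<Suc n}. \<iota> (?c i) \<otimes>\<^bsub>S\<^esub> \<theta> [^]\<^bsub>S\<^esub> i) =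
        \<iota> (?c n) \<otimes>\<^bsub>S\<^esub> \<theta> [^]\<^bsub>S\<^esub> n \<oplus>\<^bsub>S\<^esub> (\<Oplus>\<^bsub>S\<^esub>i\<in>{..<n}. \<iota> (?c i) \<otimes>\<^bsub>S\<^esub> \<theta> [^]\<^bsub>S\<^esub> i)"
      unfolding lessThan_Suc using cR g(2) by (intro S.finsum_insert) auto
    also have "(\<Oplus>\<^bsub>S\<^esub>i\<in>{..<n}. \<iota> (?c i) \<otimes>\<^bsub>S\<^esub> \<theta> [^]\<^bsub>S\<^esub> i) = g"
      unfolding c(3) using cR by (intro S.finsum_cong') auto
    also have "\<iota> (?c n) \<otimes>\<^bsub>S\<^esub> \<theta> [^]\<^bsub>S\<^esub> n \<oplus>\<^bsub>S\<^esub> g = f"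
      using g by (simp add: below_closed S.add.m_comm)
    finally have "f = (\<Oplus>\<^bsub>S\<^esub>i\<in>{..<Suc n}. \<iota> (?c i) \<otimes>\<^bsub>S\<^esub> \<theta> [^]\<^bsub>S\<^esub> i)" ..
    moreover have "range ?c \<subseteq> carrier R" using cR g(2) by auto
    moreover have "{i. ?c i \<noteq> \<zero>} \<subseteq> {..<Suc n}" using c(2) by (auto simp: subset_iff less_Suc_eq)
    ultimately show ?case by blast
  qed
  then obtain c where c: "range c \<subseteq> carrier R" "{i. c i \<noteq> \<zero>} \<subseteq> {..<n}"
    "f = (\<Oplus>\<^bsub>S\<^esub>i\<in>{..<n}. \<iota> (c i) \<otimes>\<^bsub>S\<^esub> \<theta> [^]\<^bsub>S\<^esub> i)" by blast
  show thesis using c sum_support[OF c(1,2)] by (intro that[of c]) simp_all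
qed

text \<open>As an element of \<open>below n\<close> the monomial has an expansion whose coefficient
  at \<open>n\<close> is zero; its one-term expansion has \<open>c\<close> there. Expansions are
  unique.\<close>

lemma leading_coefficient_zero:
  assumes c: "c \<in> carrier R" and mem: "\<iota> c \<otimes>\<^bsub>S\<^esub> \<theta> [^]\<^bsub>S\<^esub> n \<in> below n"
  shows "c = \<zero>"
proof -
  let ?f = "\<iota> c \<otimes>\<^bsub>S\<^esub> \<theta> [^]\<^bsub>S\<^esub> n"
  define rep where "rep e \<longleftrightarrow> range e \<subseteq> carrier R \<and> finite {i. e i \<noteq> \<zero>} \<and>
      ?f = (\<Oplus>\<^bsub>S\<^esub>i\<in>{i. e i \<noteq> \<zero>}. \<iota> (e i) \<otimes>\<^bsub>S\<^esub> \<theta> [^]\<^bsub>S\<^esub> i)" for e :: "nat \<Rightarrow> 'r"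
  obtain e where e: "range e \<subseteq> carrier R" "{i. e i \<noteq> \<zero>} \<subseteq> {..<n}"
    "?f = (\<Oplus>\<^bsub>S\<^esub>i\<in>{i. e i \<noteq> \<zero>}. \<iota> (e i) \<otimes>\<^bsub>S\<^esub> \<theta> [^]\<^bsub>S\<^esub> i)"
    using mem by (rule below_coefficients)
  have "rep e" using e finite_subset[OF e(2)] by (simp add: rep_def)
  moreover have "rep (\<lambda>i. if i = n then c else \<zero>)"
    unfolding rep_def
  proof (intro conjI)
    let ?e = "\<lambda>i. if i = n then c else \<zero>"
    show "range ?e \<subseteq> carrier R" using c by auto
    have "{i. ?e i \<noteq> \<zero>} \<subseteq> {n}" by auto
    then show "finite {i. ?e i \<noteq> \<zero>}" by (rule finite_subset) simp
    have "(\<Oplus>\<^bsub>S\<^esub>i\<in>{i. ?e i \<noteq> \<zero>}. \<iota> (?e i) \<otimes>\<^bsub>S\<^esub> \<theta> [^]\<^bsub>S\<^esub> i) =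
        (\<Oplus>\<^bsub>S\<^esub>i\<in>{n}. \<iota> (?e i) \<otimes>\<^bsub>S\<^esub> \<theta> [^]\<^bsub>S\<^esub> i)"
      using c by (intro S.add.finprod_mono_neutral_cong_left) auto
    also have "\<dots> = ?f" using c by (subst S.finsum_insert) auto
    finally show "?f = (\<Oplus>\<^bsub>S\<^esub>i\<in>{i. ?e i \<noteq> \<zero>}. \<iota> (?e i) \<otimes>\<^bsub>S\<^esub> \<theta> [^]\<^bsub>S\<^esub> i)" ..
  qed
  moreover have "\<exists>!e. rep e" unfolding rep_def using c by (intro unique_expansion) simp
  ultimately have "e = (\<lambda>i. if i = n then c else \<zero>)" by blast
  moreover have "e n = \<zero>" using e(2) by auto
  ultimately show ?thesis by simp
qed

text \<open>The factor is monic of degree 1, so a nonzero \<open>f\<close> with top term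
  \<open>c \<theta>^n\<close> yields a product with top term \<open>c \<theta>^(n+1)\<close>.
  Consequently \<open>S(\<theta> + a)\<close> contains no nonzero element of \<open>R\<close>, and
  right multiplication by \<open>\<theta>\<close> is injective.\<close>

lemma mult_linear_below_1:
  assumes a: "a \<in> carrier R" and f: "f \<in> carrier S" and mem: "f \<otimes>\<^bsub>S\<^esub> (\<theta> \<oplus>\<^bsub>S\<^esub> \<iota> a) \<in> below 1"
  shows "f = \<zero>\<^bsub>S\<^esub>"
proof (rule ccontr)
  assume nz: "f \<noteq> \<zero>\<^bsub>S\<^esub>"
  \<comment> \<open>A nonzero \<open>f\<close> is not in \<open>below 0\<close>, so the least stage
    containing it is a successor, and by minimality its top coefficient is not zero.\<close>
  have L: "f \<in> below (LEAST n. f \<in> below n)" using LeastI_ex[OF below_cover[OF f]] .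
  then obtain n where n: "(LEAST n. f \<in> below n) = Suc n"
    using nz by (cases "LEAST n. f \<in> below n") auto
  then have fn: "f \<notin> below n" using not_less_Least[of n "\<lambda>n. f \<in> below n"] by simp
  have fS: "f \<in> below (Suc n)" using L n by simp
  then obtain g c where g: "g \<in> below n" "c \<in> carrier R" "f = g \<oplus>\<^bsub>S\<^esub> \<iota> c \<otimes>\<^bsub>S\<^esub> \<theta> [^]\<^bsub>S\<^esub> n"
    by (rule below_SucE)
  let ?h = "f \<otimes>\<^bsub>S\<^esub> (\<theta> \<oplus>\<^bsub>S\<^esub> \<iota> a)"
  let ?m = "\<iota> c \<otimes>\<^bsub>S\<^esub> \<theta> [^]\<^bsub>S\<^esub> Suc n"
  let ?l = "g \<otimes>\<^bsub>S\<^esub> \<theta> \<oplus>\<^bsub>S\<^esub> f \<otimes>\<^bsub>S\<^esub> \<iota> a"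
  have "f \<otimes>\<^bsub>S\<^esub> \<theta> = g \<otimes>\<^bsub>S\<^esub> \<theta> \<oplus>\<^bsub>S\<^esub> ?m"
    using g by (simp add: below_closed S.l_distr S.m_assoc)
  then have "?h = ?m \<oplus>\<^bsub>S\<^esub> ?l"
    using f a g(1,2) by (simp add: S.r_distr below_closed S.a_ac)
  then have "?m = ?h \<oplus>\<^bsub>S\<^esub> \<ominus>\<^bsub>S\<^esub> ?l"
    using f a g(1,2) by (simp add: below_closed S.add.m_assoc S.r_neg del: S.nat_pow_Suc)
  moreover have "?l \<in> below (Suc n)"
    using below_add[OF below_mult_theta[OF g(1)] below_mult_iota[OF fS a]] .
  moreover have "?h \<in> below (Suc n)" using below_mono[OF mem] by simp
  ultimately have "?m \<in> below (Suc n)" using below_add below_minus by metis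
  then have "c = \<zero>" using leading_coefficient_zero g(2) by blast
  then show False using g fn by (simp add: below_closed)
qed

lemma iota_below_1: "r \<in> carrier R \<Longrightarrow> \<iota> r \<in> below 1"
  using below_monomial[of r 0] by simp

lemma iota_zeroD: "r \<in> carrier R \<Longrightarrow> \<iota> r = \<zero>\<^bsub>S\<^esub> \<Longrightarrow> r = \<zero>"
  using leading_coefficient_zero[of r 0] by simp

lemma iota_eq_mult_linear:
  assumes "r \<in> carrier R" "a \<in> carrier R" "f \<in> carrier S" "\<iota> r = f \<otimes>\<^bsub>S\<^esub> (\<theta> \<oplus>\<^bsub>S\<^esub> \<iota> a)"
  shows "r = \<zero>"
proof -
  have "f = \<zero>\<^bsub>S\<^esub>" using mult_linear_below_1[OF assms(2,3)] iota_below_1[OF assms(1)] assms(4) by simp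
  then show ?thesis using assms by (intro iota_zeroD) simp_all
qed

lemma mult_theta_eq_zero: "f \<in> carrier S \<Longrightarrow> f \<otimes>\<^bsub>S\<^esub> \<theta> = \<zero>\<^bsub>S\<^esub> \<Longrightarrow> f = \<zero>\<^bsub>S\<^esub>"
  using mult_linear_below_1[of \<zero> f] by simp

text \<open>Right division by a monic linear operator \<open>p\<close>. The set \<open>T\<close> of
  all \<open>b + t p\<close> contains \<open>1\<close> and is closed under addition and under left
  multiplication by \<open>R\<close> and by \<open>\<theta>\<close>, hence is all of
  \<open>S\<close>.\<close>

lemma division_by_linear:
  assumes a: "a \<in> carrier R" and s: "s \<in> carrier S"
  obtains b t where "b \<in> carrier R" "t \<in> carrier S" "s = \<iota> b \<oplus>\<^bsub>S\<^esub> t \<otimes>\<^bsub>S\<^esub> (\<theta> \<oplus>\<^bsub>S\<^esub> \<iota> a)"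
proof -
  define p where "p = \<theta> \<oplus>\<^bsub>S\<^esub> \<iota> a"
  have p: "p \<in> carrier S" using a by (simp add: p_def)
  define T where "T = {\<iota> b \<oplus>\<^bsub>S\<^esub> t \<otimes>\<^bsub>S\<^esub> p | b t. b \<in> carrier R \<and> t \<in> carrier S}"
  have TI: "\<iota> b \<oplus>\<^bsub>S\<^esub> t \<otimes>\<^bsub>S\<^esub> p \<in> T" if "b \<in> carrier R" "t \<in> carrier S" for b t
    using that unfolding T_def by blast
  have TE: "\<exists>b t. b \<in> carrier R \<and> t \<in> carrier S \<and> f = \<iota> b \<oplus>\<^bsub>S\<^esub> t \<otimes>\<^bsub>S\<^esub> p" if "f \<in> T" for f
    using that unfolding T_def by blast
  have add: "f \<oplus>\<^bsub>S\<^esub> g \<in> T" if "f \<in> T" "g \<in> T" for f g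
  proof -
    obtain b t b' t' where *: "b \<in> carrier R" "t \<in> carrier S" "b' \<in> carrier R" "t' \<in> carrier S"
      "f = \<iota> b \<oplus>\<^bsub>S\<^esub> t \<otimes>\<^bsub>S\<^esub> p" "g = \<iota> b' \<oplus>\<^bsub>S\<^esub> t' \<otimes>\<^bsub>S\<^esub> p"
      using TE[OF \<open>f \<in> T\<close>] TE[OF \<open>g \<in> T\<close>] by auto
    have "f \<oplus>\<^bsub>S\<^esub> g = \<iota> (b \<oplus> b') \<oplus>\<^bsub>S\<^esub> (t \<oplus>\<^bsub>S\<^esub> t') \<otimes>\<^bsub>S\<^esub> p"
      using p *(1-4) unfolding *(5,6) by (simp add: S.l_distr S.a_ac)
    then show ?thesis using TI[of "b \<oplus> b'" "t \<oplus>\<^bsub>S\<^esub> t'"] *(1-4) by simp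
  qed
  have scale: "\<iota> c \<otimes>\<^bsub>S\<^esub> f \<in> T" if "c \<in> carrier R" "f \<in> T" for c f
  proof -
    obtain b t where *: "b \<in> carrier R" "t \<in> carrier S" "f = \<iota> b \<oplus>\<^bsub>S\<^esub> t \<otimes>\<^bsub>S\<^esub> p"
      using TE[OF \<open>f \<in> T\<close>] by auto
    have "\<iota> c \<otimes>\<^bsub>S\<^esub> f = \<iota> (c \<otimes> b) \<oplus>\<^bsub>S\<^esub> (\<iota> c \<otimes>\<^bsub>S\<^esub> t) \<otimes>\<^bsub>S\<^esub> p"
      using p that(1) *(1,2) unfolding *(3) by (simp add: S.r_distr S.m_assoc)
    then show ?thesis using TI[of "c \<otimes> b" "\<iota> c \<otimes>\<^bsub>S\<^esub> t"] that(1) *(1,2) by simp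
  qed
  have shift: "\<theta> \<otimes>\<^bsub>S\<^esub> f \<in> T" if "f \<in> T" for f
  proof -
    obtain b t where *: "b \<in> carrier R" "t \<in> carrier S" "f = \<iota> b \<oplus>\<^bsub>S\<^esub> t \<otimes>\<^bsub>S\<^esub> p"
      using TE[OF \<open>f \<in> T\<close>] by auto
    \<comment> \<open>Commuting \<open>\<theta>\<close> past \<open>b\<close> leaves
      \<open>b \<theta> + d b\<close>, and \<open>b \<theta>\<close> is rewritten as
      \<open>b p - b a\<close>; so the new remainder is \<open>d b - b a\<close>.\<close>
    have "\<iota> b \<otimes>\<^bsub>S\<^esub> \<theta> = \<iota> b \<otimes>\<^bsub>S\<^esub> p \<oplus>\<^bsub>S\<^esub> \<iota> (\<ominus> (b \<otimes> a))"
      using a *(1) by (simp add: p_def S.r_distr S.a_assoc S.r_neg)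
    then have "\<theta> \<otimes>\<^bsub>S\<^esub> f =
        (\<iota> b \<otimes>\<^bsub>S\<^esub> p \<oplus>\<^bsub>S\<^esub> \<iota> (\<ominus> (b \<otimes> a))) \<oplus>\<^bsub>S\<^esub> \<iota> (d b) \<oplus>\<^bsub>S\<^esub> \<theta> \<otimes>\<^bsub>S\<^esub> t \<otimes>\<^bsub>S\<^esub> p"
      using p *(1,2) unfolding *(3) by (simp add: S.r_distr S.m_assoc theta_iota)
    also have "\<dots> = \<iota> (d b \<oplus> \<ominus> (b \<otimes> a)) \<oplus>\<^bsub>S\<^esub> (\<iota> b \<oplus>\<^bsub>S\<^esub> \<theta> \<otimes>\<^bsub>S\<^esub> t) \<otimes>\<^bsub>S\<^esub> p"
      using a p *(1,2) by (simp add: S.l_distr S.m_assoc S.a_ac)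
    finally show ?thesis
      using TI[of "d b \<oplus> \<ominus> (b \<otimes> a)" "\<iota> b \<oplus>\<^bsub>S\<^esub> \<theta> \<otimes>\<^bsub>S\<^esub> t"] a *(1,2) by simp
  qed
  have zero: "\<zero>\<^bsub>S\<^esub> \<in> T" using TI[of \<zero> "\<zero>\<^bsub>S\<^esub>"] p by simp
  have one: "\<one>\<^bsub>S\<^esub> \<in> T" using TI[of \<one> "\<zero>\<^bsub>S\<^esub>"] p by simp
  have pow: "\<theta> [^]\<^bsub>S\<^esub> (n::nat) \<in> T" for n
  proof (induction n)
    case (Suc n)
    then show ?case using shift[OF Suc.IH] S.nat_pow_Suc2[OF theta, of n] by simp
  qed (simp add: one)
  have "f \<in> T" if "f \<in> below n" for f n
    using that by (induction n arbitrary: f) (auto simp: zero elim!: below_SucE intro: add scale pow)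
  then have "s \<in> T" using below_cover[OF s] by blast
  then show thesis using TE that unfolding p_def by blast
qed

lemma division_by_theta:
  assumes "s \<in> carrier S"
  obtains b t where "b \<in> carrier R" "t \<in> carrier S" "s = \<iota> b \<oplus>\<^bsub>S\<^esub> t \<otimes>\<^bsub>S\<^esub> \<theta>"
  using division_by_linear[OF zero_closed assms] by auto

lemma iota_eq_mult_theta: "r \<in> carrier R \<Longrightarrow> f \<in> carrier S \<Longrightarrow> \<iota> r = f \<otimes>\<^bsub>S\<^esub> \<theta> \<Longrightarrow> r = \<zero>"
  using iota_eq_mult_linear[of r \<zero> f] by simp

end

section \<open>Left ideals around \<open>S \<theta>\<close>, and the ring of constants\<close>

context differential_operator_ring
begin

text \<open>Identify \<open>S/S \<theta>\<close> with \<open>R\<close>. Then \<open>\<theta>\<close>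
  acts as \<open>d\<close>, because \<open>\<theta> r = r \<theta> + d r\<close>.\<close>

lemma theta_pow_shift:
  assumes J: "submodule J S (regular_module S)" and "r \<in> carrier R" "s \<in> carrier S"
    and "\<iota> r \<oplus>\<^bsub>S\<^esub> s \<otimes>\<^bsub>S\<^esub> \<theta> \<in> J"
  shows "\<exists>t\<in>carrier S. \<iota> ((d ^^ n) r) \<oplus>\<^bsub>S\<^esub> t \<otimes>\<^bsub>S\<^esub> \<theta> \<in> J"
proof (induction n)
  case 0
  then show ?case using assms by auto
next
  case (Suc n)
  interpret L: left_module S "regular_module S" by (rule regular_left_module[OF S.ring_axioms])
  obtain t where t: "t \<in> carrier S" "\<iota> ((d ^^ n) r) \<oplus>\<^bsub>S\<^esub> t \<otimes>\<^bsub>S\<^esub> \<theta> \<in> J" using Suc.IH by blast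
  let ?r = "(d ^^ n) r"
  have "\<theta> \<otimes>\<^bsub>S\<^esub> (\<iota> ?r \<oplus>\<^bsub>S\<^esub> t \<otimes>\<^bsub>S\<^esub> \<theta>) = \<iota> (d ?r) \<oplus>\<^bsub>S\<^esub> (\<iota> ?r \<oplus>\<^bsub>S\<^esub> \<theta> \<otimes>\<^bsub>S\<^esub> t) \<otimes>\<^bsub>S\<^esub> \<theta>"
    using t(1) assms(2) by (simp add: S.r_distr S.l_distr theta_iota S.m_assoc S.a_ac)
  moreover have "\<theta> \<otimes>\<^bsub>S\<^esub> (\<iota> ?r \<oplus>\<^bsub>S\<^esub> t \<otimes>\<^bsub>S\<^esub> \<theta>) \<in> J"
    using L.submoduleD(5)[OF J _ t(2), of \<theta>] by simp
  ultimately show ?case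
    using t(1) assms(2) by (intro bexI[of _ "\<iota> ?r \<oplus>\<^bsub>S\<^esub> \<theta> \<otimes>\<^bsub>S\<^esub> t"]) simp_all
qed

text \<open>Multiplying by \<open>\<theta>\<close>, an element of a left ideal not in \<open>S\<theta>\<close> becomes \<open>c + s \<theta>\<close> with a nonzero
  constant \<open>c\<close>.  If \<open>\<theta> (c + s \<theta>)\<close> were in \<open>S(\<theta> + a)\<theta>\<close>, the remainder \<open>b\<close> of \<open>s\<close> modulo \<open>\<theta> + a\<close> would
  satisfy \<open>b a = c + d b\<close>.\<close>

lemma theta_ideal_essential:
  assumes "nc_domain R" and nil: "locally_nilpotent R d"
    and torsion_free: "\<And>(N::nat) y. \<lbrakk> N > 0; y \<in> carrier R; [N] \<cdot>\<^bsub>R\<^esub> y = \<zero> \<rbrakk> \<Longrightarrow> y = \<zero>"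
    and a: "a \<in> carrier R" "d a \<noteq> \<zero>"
    and J: "submodule J S (regular_module S)"
    and LJ: "principal_left_ideal S ((\<theta> \<oplus>\<^bsub>S\<^esub> \<iota> a) \<otimes>\<^bsub>S\<^esub> \<theta>) \<subseteq> J"
    and JA: "J \<inter> principal_left_ideal S \<theta> \<subseteq> principal_left_ideal S ((\<theta> \<oplus>\<^bsub>S\<^esub> \<iota> a) \<otimes>\<^bsub>S\<^esub> \<theta>)"
  shows "J = principal_left_ideal S ((\<theta> \<oplus>\<^bsub>S\<^esub> \<iota> a) \<otimes>\<^bsub>S\<^esub> \<theta>)" (is "J = ?L")
proof
  interpret L: left_module S "regular_module S" by (rule regular_left_module[OF S.ring_axioms])
  define p where "p = \<theta> \<oplus>\<^bsub>S\<^esub> \<iota> a"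
  have p: "p \<in> carrier S" using a by (simp add: p_def)
  show "J \<subseteq> ?L"
  proof
    fix y assume y: "y \<in> J"
    then have "y \<in> carrier S" using L.submoduleD(2)[OF J] by simp
    then obtain r s where rs: "r \<in> carrier R" "s \<in> carrier S" "y = \<iota> r \<oplus>\<^bsub>S\<^esub> s \<otimes>\<^bsub>S\<^esub> \<theta>"
      by (rule division_by_theta)
    have "r = \<zero>"
    proof (rule ccontr)
      assume "r \<noteq> \<zero>"
      then obtain n where n: "(d ^^ n) r \<noteq> \<zero>" "(d ^^ Suc n) r = \<zero>"
        using last_nonzero_derivative[OF nil rs(1)] by blast
      define c where "c = (d ^^ n) r"
      have c: "c \<in> carrier R" "d c = \<zero>" "c \<noteq> \<zero>" using n rs(1) by (simp_all add: c_def)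
      obtain t where t: "t \<in> carrier S" "\<iota> c \<oplus>\<^bsub>S\<^esub> t \<otimes>\<^bsub>S\<^esub> \<theta> \<in> J"
        using theta_pow_shift[OF J rs(1,2)] y rs(3) unfolding c_def by blast
      \<comment> \<open>A constant commutes with \<open>\<theta>\<close>, so multiplying by
        \<open>\<theta>\<close> from the left moves the element into \<open>S \<theta>\<close>,
        where the hypothesis \<open>JA\<close> applies.\<close>
      have eq: "\<theta> \<otimes>\<^bsub>S\<^esub> (\<iota> c \<oplus>\<^bsub>S\<^esub> t \<otimes>\<^bsub>S\<^esub> \<theta>) = (\<iota> c \<oplus>\<^bsub>S\<^esub> \<theta> \<otimes>\<^bsub>S\<^esub> t) \<otimes>\<^bsub>S\<^esub> \<theta>"
        using c t(1) by (simp add: S.r_distr S.l_distr theta_iota S.m_assoc)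
      have "\<theta> \<otimes>\<^bsub>S\<^esub> (\<iota> c \<oplus>\<^bsub>S\<^esub> t \<otimes>\<^bsub>S\<^esub> \<theta>) \<in> J" using L.submoduleD(5)[OF J _ t(2), of \<theta>] by simp
      moreover have "(\<iota> c \<oplus>\<^bsub>S\<^esub> \<theta> \<otimes>\<^bsub>S\<^esub> t) \<otimes>\<^bsub>S\<^esub> \<theta> \<in> principal_left_ideal S \<theta>"
        by (rule principal_left_idealI) (use c t(1) in simp)
      ultimately have "(\<iota> c \<oplus>\<^bsub>S\<^esub> \<theta> \<otimes>\<^bsub>S\<^esub> t) \<otimes>\<^bsub>S\<^esub> \<theta> \<in> ?L"
        unfolding eq using JA by blast
      then obtain u where u: "u \<in> carrier S" "(\<iota> c \<oplus>\<^bsub>S\<^esub> \<theta> \<otimes>\<^bsub>S\<^esub> t) \<otimes>\<^bsub>S\<^esub> \<theta> = u \<otimes>\<^bsub>S\<^esub> (p \<otimes>\<^bsub>S\<^esub> \<theta>)"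
        unfolding p_def by (rule principal_left_idealE)
      have "(\<iota> c \<oplus>\<^bsub>S\<^esub> \<theta> \<otimes>\<^bsub>S\<^esub> t \<ominus>\<^bsub>S\<^esub> u \<otimes>\<^bsub>S\<^esub> p) \<otimes>\<^bsub>S\<^esub> \<theta> =
          (\<iota> c \<oplus>\<^bsub>S\<^esub> \<theta> \<otimes>\<^bsub>S\<^esub> t) \<otimes>\<^bsub>S\<^esub> \<theta> \<ominus>\<^bsub>S\<^esub> u \<otimes>\<^bsub>S\<^esub> (p \<otimes>\<^bsub>S\<^esub> \<theta>)"
        using c t(1) u(1) p by (simp add: S.minus_eq S.l_distr S.l_minus S.m_assoc)
      also have "\<dots> = \<zero>\<^bsub>S\<^esub>" unfolding u(2) using u(1) p by (simp add: S.minus_eq S.r_neg)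
      finally have "\<iota> c \<oplus>\<^bsub>S\<^esub> \<theta> \<otimes>\<^bsub>S\<^esub> t \<ominus>\<^bsub>S\<^esub> u \<otimes>\<^bsub>S\<^esub> p = \<zero>\<^bsub>S\<^esub>"
        by (rule mult_theta_eq_zero[rotated]) (use c t(1) u(1) p in simp)
      then have up: "\<iota> c \<oplus>\<^bsub>S\<^esub> \<theta> \<otimes>\<^bsub>S\<^esub> t = u \<otimes>\<^bsub>S\<^esub> p" using c t(1) u(1) p by simp
      \<comment> \<open>Both sides of \<open>c + \<theta> t = u p\<close> are now compared modulo
        \<open>S p\<close>: the left one has remainder \<open>c + d b - b a\<close>, the right one
        \<open>0\<close>.\<close>
      obtain b v where bv: "b \<in> carrier R" "v \<in> carrier S" "t = \<iota> b \<oplus>\<^bsub>S\<^esub> v \<otimes>\<^bsub>S\<^esub> p"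
        using division_by_linear[OF a(1) t(1)] unfolding p_def by blast
      have "\<iota> b \<otimes>\<^bsub>S\<^esub> \<theta> = \<iota> b \<otimes>\<^bsub>S\<^esub> p \<oplus>\<^bsub>S\<^esub> \<iota> (\<ominus> (b \<otimes> a))"
        using a(1) bv(1) by (simp add: p_def S.r_distr S.a_assoc S.r_neg)
      then have "u \<otimes>\<^bsub>S\<^esub> p = \<iota> c \<oplus>\<^bsub>S\<^esub> ((\<iota> b \<otimes>\<^bsub>S\<^esub> p \<oplus>\<^bsub>S\<^esub> \<iota> (\<ominus> (b \<otimes> a))) \<oplus>\<^bsub>S\<^esub> \<iota> (d b) \<oplus>\<^bsub>S\<^esub> \<theta> \<otimes>\<^bsub>S\<^esub> v \<otimes>\<^bsub>S\<^esub> p)"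
        unfolding up[symmetric] bv(3) using bv(1,2) p c by (simp add: S.r_distr theta_iota S.m_assoc)
      also have "\<dots> = \<iota> (c \<oplus> d b \<ominus> b \<otimes> a) \<oplus>\<^bsub>S\<^esub> (\<iota> b \<oplus>\<^bsub>S\<^esub> \<theta> \<otimes>\<^bsub>S\<^esub> v) \<otimes>\<^bsub>S\<^esub> p"
        using bv(1,2) p c a(1) by (simp add: minus_eq S.l_distr S.a_ac)
      finally have sum: "u \<otimes>\<^bsub>S\<^esub> p = \<iota> (c \<oplus> d b \<ominus> b \<otimes> a) \<oplus>\<^bsub>S\<^esub> (\<iota> b \<oplus>\<^bsub>S\<^esub> \<theta> \<otimes>\<^bsub>S\<^esub> v) \<otimes>\<^bsub>S\<^esub> p" .
      define w where "w = c \<oplus> d b \<ominus> b \<otimes> a"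
      \<comment> \<open>From here to the end of the block \<open>y\<close> is a quotient of division
        by \<open>p\<close>; it hides the element of \<open>J\<close> fixed above.\<close>
      define y where "y = \<iota> b \<oplus>\<^bsub>S\<^esub> \<theta> \<otimes>\<^bsub>S\<^esub> v"
      have wy: "w \<in> carrier R" "y \<in> carrier S" using bv(1,2) c(1) a(1) by (simp_all add: w_def y_def)
      have "(u \<ominus>\<^bsub>S\<^esub> y) \<otimes>\<^bsub>S\<^esub> p = (\<iota> w \<oplus>\<^bsub>S\<^esub> y \<otimes>\<^bsub>S\<^esub> p) \<ominus>\<^bsub>S\<^esub> y \<otimes>\<^bsub>S\<^esub> p"
        unfolding sum[folded w_def y_def, symmetric]
        using u(1) p wy by (simp add: S.minus_eq S.l_distr S.l_minus)
      also have "\<dots> = \<iota> w" using p wy by (simp add: S.minus_eq S.a_assoc S.r_neg)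
      finally have "w = \<zero>"
        unfolding p_def using iota_eq_mult_linear[OF wy(1) a(1), of "u \<ominus>\<^bsub>S\<^esub> y"] u(1) wy(2) by simp
      then have "c \<oplus> d b \<ominus> b \<otimes> a = \<zero>" by (simp add: w_def)
      then have "b \<otimes> a = c \<oplus> d b" using bv(1) c(1) a(1) by simp
      then have "c = \<zero>"
        by (rule twisted_eigenvector_trivial[OF assms(1) nil _ a bv(1) c(1,2), rotated])
          (rule torsion_free)
      with c(3) show False ..
    qed
    then have "y = s \<otimes>\<^bsub>S\<^esub> \<theta>" using rs by simp
    then show "y \<in> ?L" using JA y principal_left_idealI[OF rs(2)] by blast
  qed
qed fact

lemma constants_closed:
  "\<zero> \<in> constants R d" "\<one> \<in> constants R d"
  "a \<in> constants R d \<Longrightarrow> b \<in> constants R d \<Longrightarrow> a \<oplus> b \<in> constants R d"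
  "a \<in> constants R d \<Longrightarrow> b \<in> constants R d \<Longrightarrow> a \<otimes> b \<in> constants R d"
  "a \<in> constants R d \<Longrightarrow> \<ominus> a \<in> constants R d"
  by (simp_all add: constants_def d_add d_mult d_minus)

lemma constants_subring: "subring (constants R d) R"
  by (rule subringI) (use constants_closed in \<open>auto simp: constants_def\<close>)

lemma constants_pow: "c \<in> constants R d \<Longrightarrow> c [^] (n::nat) \<in> constants R d"
  by (induction n) (simp_all add: constants_closed)

text \<open>The left ideals \<open>S \<theta> + S c\<^sup>n\<close> form a descending chain; it becomes stationary only if \<open>c\<close> has a
  left inverse.\<close>

lemma constant_left_invertible:
  assumes "nc_domain R" and c: "c \<in> constants R d" "c \<noteq> \<zero>"
    and dcc: "dcc_between S (regular_module S) (principal_left_ideal S \<theta>) (carrier S)"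
  shows "\<exists>r\<in>constants R d. r \<otimes> c = \<one>"
proof -
  interpret nc_domain R by fact
  interpret L: left_module S "regular_module S" by (rule regular_left_module[OF S.ring_axioms])
  let ?A = "principal_left_ideal S \<theta>"
  have cR: "c \<in> carrier R" using c by (simp add: constants_def)
  have pR: "c [^] n \<in> carrier R" for n :: nat using cR by simp
  have dp: "d (c [^] n) = \<zero>" for n :: nat using constants_pow[OF c(1)] by (simp add: constants_def)
  define P where "P n = principal_left_ideal S (\<iota> (c [^] n))" for n :: nat
  have P: "submodule (P n) S (regular_module S)" for n
    unfolding P_def using pR by (intro submodule_principal_left_ideal S.ring_axioms) simp
  have A: "submodule ?A S (regular_module S)"
    by (intro submodule_principal_left_ideal S.ring_axioms theta)
  have dec: "P (Suc n) \<subseteq> P n" for n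
  proof
    fix y assume "y \<in> P (Suc n)"
    then obtain s where s: "s \<in> carrier S" "y = s \<otimes>\<^bsub>S\<^esub> \<iota> (c [^] Suc n)"
      unfolding P_def by (rule principal_left_idealE)
    have "c [^] Suc n = c \<otimes> c [^] n" by (rule nat_pow_Suc2[OF cR])
    then have "y = (s \<otimes>\<^bsub>S\<^esub> \<iota> c) \<otimes>\<^bsub>S\<^esub> \<iota> (c [^] n)"
      using s cR pR by (simp add: S.m_assoc del: nat_pow_Suc)
    then show "y \<in> P n" unfolding P_def using s(1) cR by (simp add: principal_left_idealI)
  qed
  let ?J = "\<lambda>n. ?A <+>\<^bsub>regular_module S\<^esub> P n"
  note J = L.submodule_set_add[OF A P]
  obtain k where k: "\<And>i. i \<ge> k \<Longrightarrow> ?J i = ?J k"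
  proof (rule dcc_betweenD[OF dcc J(1,2)])
    show "?J i \<subseteq> carrier S" for i using L.submoduleD(1)[OF J(1)] by simp
    show "?J (Suc i) \<subseteq> ?J i" for i using dec[of i] by (blast elim: L.set_addE intro: L.set_addI)
  qed auto
  have "\<iota> (c [^] k) \<in> P k"
    using principal_left_idealI[OF S.one_closed, of "\<iota> (c [^] k)"] pR unfolding P_def by simp
  then have "\<iota> (c [^] k) \<in> ?J (Suc k)" using J(3)[of k] k[of "Suc k"] by auto
  then obtain y z where yz: "y \<in> ?A" "z \<in> P (Suc k)" "\<iota> (c [^] k) = y \<oplus>\<^bsub>S\<^esub> z"
    by (auto elim!: L.set_addE)
  obtain s where s: "s \<in> carrier S" "y = s \<otimes>\<^bsub>S\<^esub> \<theta>" using yz(1) by (rule principal_left_idealE)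
  let ?e = "c [^] Suc k"
  have e: "?e \<in> carrier R" "d ?e = \<zero>" using pR[of "Suc k"] dp[of "Suc k"] by auto
  obtain t where t: "t \<in> carrier S" "z = t \<otimes>\<^bsub>S\<^esub> \<iota> ?e"
    using yz(2) unfolding P_def by (rule principal_left_idealE)
  \<comment> \<open>Everything is reduced modulo \<open>S \<theta>\<close>: the constant
    \<open>?e\<close> commutes with \<open>\<theta>\<close>, so \<open>t\<close> times
    \<open>?e\<close> has remainder \<open>r\<close> times \<open>?e\<close>, and comparing
    remainders gives \<open>c^k = r c^(k+1)\<close>.\<close>
  obtain r u where ru: "r \<in> carrier R" "u \<in> carrier S" "t = \<iota> r \<oplus>\<^bsub>S\<^esub> u \<otimes>\<^bsub>S\<^esub> \<theta>"
    using t(1) by (rule division_by_theta)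
  have comm: "\<theta> \<otimes>\<^bsub>S\<^esub> \<iota> ?e = \<iota> ?e \<otimes>\<^bsub>S\<^esub> \<theta>" using theta_iota[OF e(1)] e by (simp del: nat_pow_Suc)
  have "z = \<iota> (r \<otimes> ?e) \<oplus>\<^bsub>S\<^esub> (u \<otimes>\<^bsub>S\<^esub> \<iota> ?e) \<otimes>\<^bsub>S\<^esub> \<theta>"
    unfolding t(2) ru(3) using ru(1,2) e comm
    by (simp add: S.l_distr S.m_assoc del: nat_pow_Suc)
  then have "\<iota> (c [^] k) = \<iota> (r \<otimes> ?e) \<oplus>\<^bsub>S\<^esub> (s \<oplus>\<^bsub>S\<^esub> u \<otimes>\<^bsub>S\<^esub> \<iota> ?e) \<otimes>\<^bsub>S\<^esub> \<theta>"
    unfolding yz(3) s(2) using s(1) ru(1,2) e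
    by (simp add: S.l_distr S.a_ac del: nat_pow_Suc)
  then have "\<iota> (c [^] k \<ominus> r \<otimes> ?e) = (s \<oplus>\<^bsub>S\<^esub> u \<otimes>\<^bsub>S\<^esub> \<iota> ?e) \<otimes>\<^bsub>S\<^esub> \<theta>"
    using s(1) ru(1,2) e pR[of k] S.add.m_comm[of "\<iota> (r \<otimes> ?e)"]
    by (simp add: minus_eq S.a_assoc S.r_neg del: nat_pow_Suc hom.hom_mult)
  then have "c [^] k \<ominus> r \<otimes> ?e = \<zero>"
    by (rule iota_eq_mult_theta[rotated 2])
      (use s(1) ru(1,2) e pR[of k] in \<open>simp_all del: nat_pow_Suc\<close>)
  then have "c [^] k = r \<otimes> (c \<otimes> c [^] k)"
    using ru(1) e pR[of k] nat_pow_Suc2[OF cR, of k] by (simp del: nat_pow_Suc)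
  then have "(\<one> \<ominus> r \<otimes> c) \<otimes> c [^] k = \<zero>"
    using ru(1) cR by (simp add: minus_eq l_distr l_minus m_assoc r_neg)
  moreover have "c [^] (n::nat) \<noteq> \<zero>" for n
    using no_zero_divisors[OF _ _ cR] pR c(2) one_not_zero by (induction n) auto
  ultimately have "\<one> \<ominus> r \<otimes> c = \<zero>" using no_zero_divisors pR[of k] ru(1) cR by blast
  then have rc: "r \<otimes> c = \<one>" using ru(1) cR by simp
  \<comment> \<open>The left inverse found in \<open>R\<close> is itself a constant:
    \<open>d r\<close> times \<open>c\<close> equals \<open>d\<close> of \<open>1\<close>, since
    \<open>d c = 0\<close>.\<close>
  have "d r \<otimes> c = d (r \<otimes> c)" using ru(1) cR c(1) by (simp add: d_mult constants_def)
  also have "\<dots> = \<zero>" unfolding rc by simp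
  finally have "d r = \<zero>" using no_zero_divisors[OF _ d_closed[OF ru(1)] cR] c(2) by blast
  then show ?thesis using rc ru(1) by (auto simp: constants_def)
qed

end

text \<open>Take a left inverse \<open>r\<close> of \<open>c\<close> and a left inverse
  \<open>s\<close> of \<open>r\<close>. Then \<open>s = s (r c) = (s r) c = c\<close>, so
  \<open>r\<close> is a two-sided inverse of \<open>c\<close>.\<close>

lemma skew_field_if_left_inverses:
  assumes "ring T" and nontrivial: "\<one>\<^bsub>T\<^esub> \<noteq> \<zero>\<^bsub>T\<^esub>"
    and inv: "\<And>c. c \<in> carrier T \<Longrightarrow> c \<noteq> \<zero>\<^bsub>T\<^esub> \<Longrightarrow> \<exists>r\<in>carrier T. r \<otimes>\<^bsub>T\<^esub> c = \<one>\<^bsub>T\<^esub>"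
  shows "skew_field T"
proof -
  interpret ring T by fact
  have "c \<in> Units T" if c: "c \<in> carrier T" "c \<noteq> \<zero>\<^bsub>T\<^esub>" for c
  proof -
    obtain r where r: "r \<in> carrier T" "r \<otimes>\<^bsub>T\<^esub> c = \<one>\<^bsub>T\<^esub>" using inv[OF c] by blast
    then have "r \<noteq> \<zero>\<^bsub>T\<^esub>" using c nontrivial by auto
    then obtain s where s: "s \<in> carrier T" "s \<otimes>\<^bsub>T\<^esub> r = \<one>\<^bsub>T\<^esub>" using inv[OF r(1)] by blast
    have "s = s \<otimes>\<^bsub>T\<^esub> (r \<otimes>\<^bsub>T\<^esub> c)" using r s by simp
    also have "\<dots> = (s \<otimes>\<^bsub>T\<^esub> r) \<otimes>\<^bsub>T\<^esub> c" using r(1) s(1) c(1) by (simp only: m_assoc)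
    also have "\<dots> = c" using s(2) c(1) by simp
    finally show ?thesis using r s c unfolding Units_def by auto
  qed
  moreover have "\<zero>\<^bsub>T\<^esub> \<notin> Units T" using nontrivial unfolding Units_def by auto
  ultimately have "Units T = carrier T - {\<zero>\<^bsub>T\<^esub>}" using Units_closed by blast
  then show ?thesis by (intro skew_field.intro skew_field_axioms.intro ring_axioms)
qed

section \<open>Scalars: the copy of the base field, and freedom from torsion\<close>

lemma (in nc_algebra) scalar_hom: "(\<lambda>k. k \<odot>\<^bsub>M\<^esub> \<one>\<^bsub>M\<^esub>) \<in> ring_hom R M"
proof (rule ring_hom_memI)
  fix k l assume "k \<in> carrier R" "l \<in> carrier R"
  then show "(k \<otimes> l) \<odot>\<^bsub>M\<^esub> \<one>\<^bsub>M\<^esub> = (k \<odot>\<^bsub>M\<^esub> \<one>\<^bsub>M\<^esub>) \<otimes>\<^bsub>M\<^esub> (l \<odot>\<^bsub>M\<^esub> \<one>\<^bsub>M\<^esub>)"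
    by (simp add: smult_mult_left smult_assoc1)
qed (simp_all add: smult_l_distr)

lemma (in nc_algebra) add_pow_smult:
  assumes "k \<in> carrier R" "y \<in> carrier M"
  shows "([(N::nat)] \<cdot>\<^bsub>R\<^esub> k) \<odot>\<^bsub>M\<^esub> y = [N] \<cdot>\<^bsub>M\<^esub> (k \<odot>\<^bsub>M\<^esub> y)"
  using assms by (induction N) (simp_all add: smult_l_distr)

text \<open>Taking an integer multiple is the action of a scalar, the \<open>N\<close>-fold sum of
  \<open>1\<close>, which is nonzero in characteristic 0 and hence invertible in the field.\<close>

lemma (in nc_algebra) char_zero_torsion_free:
  assumes "field R" "characteristic_zero R" "N > 0" and y: "y \<in> carrier M" "[(N::nat)] \<cdot>\<^bsub>M\<^esub> y = \<zero>\<^bsub>M\<^esub>"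
  shows "y = \<zero>\<^bsub>M\<^esub>"
proof -
  interpret K: field R by fact
  let ?n = "[N] \<cdot>\<^bsub>R\<^esub> \<one>"
  have n: "?n \<in> carrier R" "?n \<noteq> \<zero>" using assms(2,3) by (auto simp: characteristic_zero_def)
  then have u: "?n \<in> Units R" using K.field_Units by blast
  have "?n \<odot>\<^bsub>M\<^esub> y = \<zero>\<^bsub>M\<^esub>" using add_pow_smult[of \<one> y N] y by simp
  then have "(inv ?n \<otimes> ?n) \<odot>\<^bsub>M\<^esub> y = \<zero>\<^bsub>M\<^esub>"
    using smult_assoc1[of "inv ?n" ?n y] R.Units_inv_closed[OF u] n(1) y(1) by simp
  then show ?thesis using R.Units_l_inv[OF u] y(1) by simp
qed

theorem theorem2p2:
  fixes K :: "('k, 'u) ring_scheme"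
    and R :: "('k, 'r, 'v) module_scheme"
    and S :: "('s, 'w) ring_scheme"
    and d :: "'r \<Rightarrow> 'r" and x :: 'r
    and \<iota> :: "'r \<Rightarrow> 's" and \<theta> :: 's
  assumes "field K" and "characteristic_zero K"
    and "nc_algebra K R" and "nc_domain R" and "nc_noetherian R"
    and "derivation R d" and "locally_nilpotent R d"
    and "x \<in> carrier R" and "d x = \<one>\<^bsub>R\<^esub>"
    and "diff_op_ring R d S \<iota> \<theta>"
    and "diamond S"
    and "\<exists>a \<in> carrier R - constants R d.
           artinian_module S
             (quotient_module (regular_module S) (principal_left_ideal S (\<theta> \<oplus>\<^bsub>S\<^esub> \<iota> a)))"
  shows "skew_field (R\<lparr>carrier := constants R d\<rparr>)"
proof -
  interpret K: field K by fact
  interpret alg: nc_algebra K R by fact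
  interpret R: nc_domain R by fact
  have R: "ring R" by (rule nc_domain.axioms(1)) fact
  have S: "ring S" using assms(10) by (simp add: diff_op_ring_def)
  interpret differential_operator_ring R d S \<iota> \<theta>
    using S assms(6,10) R
    by (intro differential_operator_ring.intro derivation_ring.intro derivation_ring_axioms.intro
        differential_operator_ring_axioms.intro) auto
  interpret L: left_module S "regular_module S" by (rule regular_left_module[OF S])
  obtain a where a: "a \<in> carrier R" "d a \<noteq> \<zero>\<^bsub>R\<^esub>"
    and art: "artinian_module S (quotient_module (regular_module S) (principal_left_ideal S (\<theta> \<oplus>\<^bsub>S\<^esub> \<iota> a)))"
    using assms(12) by (auto simp: constants_def)
  let ?p = "\<theta> \<oplus>\<^bsub>S\<^esub> \<iota> a" and ?A = "principal_left_ideal S \<theta>"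
  let ?L = "principal_left_ideal S (?p \<otimes>\<^bsub>S\<^esub> \<theta>)"
  have p: "?p \<in> carrier S" using a by simp
  have LA: "?L \<subseteq> ?A"
  proof
    fix y assume "y \<in> ?L"
    then obtain s where s: "s \<in> carrier S" "y = s \<otimes>\<^bsub>S\<^esub> (?p \<otimes>\<^bsub>S\<^esub> \<theta>)" by (rule principal_left_idealE)
    then have "y = (s \<otimes>\<^bsub>S\<^esub> ?p) \<otimes>\<^bsub>S\<^esub> \<theta>" using p by (simp only: S.m_assoc theta)
    then show "y \<in> ?A" using s(1) p by (simp only: principal_left_idealI S.m_closed)
  qed
  \<comment> \<open>The image of \<open>K\<close> in \<open>S\<close> is the field from which
    modules are coinduced. It is a subfield because \<open>\<one> \<noteq> \<zero>\<close> holds in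
    \<open>S\<close>, which in turn comes from the injectivity of \<open>\<iota>\<close>.\<close>
  define F where "F = (\<lambda>k. \<iota> (k \<odot>\<^bsub>R\<^esub> \<one>\<^bsub>R\<^esub>)) ` carrier K"
  have "\<one>\<^bsub>S\<^esub> \<noteq> \<zero>\<^bsub>S\<^esub>" using iota_zeroD[of "\<one>\<^bsub>R\<^esub>"] R.one_not_zero by auto
  moreover have "\<iota> \<circ> (\<lambda>k. k \<odot>\<^bsub>R\<^esub> \<one>\<^bsub>R\<^esub>) \<in> ring_hom K S"
    by (rule ring_hom_trans[OF alg.scalar_hom iota_hom])
  then have "ring_hom_ring K S (\<lambda>k. \<iota> (k \<odot>\<^bsub>R\<^esub> \<one>\<^bsub>R\<^esub>))"
    by (intro ring_hom_ringI2 K.ring_axioms S) (simp add: comp_def)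
  ultimately have F: "subfield F S"
    unfolding F_def using ring_hom_ring.img_is_subfield(2)[OF _ K.carrier_is_subfield] by blast
  have subF: "subring F S" using subfieldE(1)[OF F] .
  have skewF: "skew_field (S\<lparr>carrier := F\<rparr>)"
    using subfield.subfield_Units[OF F]
    by (intro skew_field.intro skew_field_axioms.intro S.subring_is_ring subF) simp
  have torsion_free: "y = \<zero>\<^bsub>R\<^esub>" if "N > 0" "y \<in> carrier R" "[N] \<cdot>\<^bsub>R\<^esub> y = \<zero>\<^bsub>R\<^esub>" for N :: nat and y
    using alg.char_zero_torsion_free[OF assms(1,2)] that by blast
  note idl = submodule_principal_left_ideal[OF S]
  have "dcc_between S (regular_module S) (principal_left_ideal S ?p) (carrier S)"
    using L.artinian_quotient_dcc[OF idl[OF p] art] by simp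
  then have "dcc_between S (regular_module S) ?L ?A" by (rule dcc_right_multiple[OF S p theta])
  then have "dcc_between S (regular_module S) ?L (carrier S)"
    using theta_ideal_essential[OF assms(4,7) torsion_free a] p LA
    by (intro diamond_essential_dcc[OF S subF skewF assms(11) idl idl]) simp_all
  \<comment> \<open>Chains above \<open>S \<theta>\<close> are in particular chains above the
    smaller left ideal \<open>?L\<close>.\<close>
  then have dcc: "dcc_between S (regular_module S) ?A (carrier S)" using LA by (rule dcc_between_mono)
  show ?thesis
  proof (rule skew_field_if_left_inverses)
    show "ring (R\<lparr>carrier := constants R d\<rparr>)" by (rule ring.subring_is_ring[OF R constants_subring])
    show "\<one>\<^bsub>R\<lparr>carrier := constants R d\<rparr>\<^esub> \<noteq> \<zero>\<^bsub>R\<lparr>carrier := constants R d\<rparr>\<^esub>"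
      using R.one_not_zero by simp
  qed (use constant_left_invertible[OF assms(4) _ _ dcc] in simp)
qed

end
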